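(* Let $n\ge1$. (a) Let $\mathcal G\subseteq\mathbb C^{n\times n}$ be the congruence bundle $$\mathcal G:=\begin{cases}\mathcal B^c\left(\bigoplus_{i=1}^{n/2}H_2(\mu_i)\right), & \text{if } n \text{ is even},\\ \mathcal B^c\left(\bigoplus_{i=1}^{\lfloor n/2\rfloor}H_2(\mu_i)\oplus 1\right), & \text{if } n\text{ is odd},\end{cases}$$ where, for each $i=1,\dots,\lfloor n/2\rfloor$, either $|\mu_i|>1$ or $\mu_i=e^{\mathfrak i\theta}$ for some $0<\theta<\pi$, and $\mu_i\ne\mu_{i'}$ if $i\neq i'$. Then $\mathcal G$ is an open subset of $\mathbb C^{n\times n}$; that is, for any $A\in\mathcal G$ there exists $\varepsilon>0$ such that $$\mathcal U_\varepsilon(A):=\{S\in\mathbb C^{n\times n}:\ \|A-S\|_F<\varepsilon\}\subset\mathcal G.$$ (b) For $\ell=0,1,\dots,\lfloor n/2\rfloor$ let $\mathcal G_\ell\subseteq\mathbb C^{n\times n}$ be the $^*$congruence bundle $$\mathcal G_\ell:=\mathcal B^*\left(\bigoplus_{i=1}^{\ell}H_2(\mu_i)\oplus\bigoplus_{j=1}^{n-2\ell}\alpha_j\right),$$ where $|\mu_i|>1$ and $\mu_i\ne\mu_{i'}$ if $i\ne i'$, for all $i,i'=1,\dots,\ell$, and $|\alpha_j|=1$ and $\alpha_j^2\neq\alpha_{j'}^2$ if $j\neq j'$, for all $j,j'=1,\dots,n-2\ell$. Then $\mathcal G_\ell$ is an open subset of $\mathbb C^{n\times n}$ for every $\ell=0,1,\dots,\lfloor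 n/2\rfloor$; that is, for any $A\in\mathcal G_\ell$ there exists $\varepsilon>0$ such that $$\mathcal U_\varepsilon(A):=\{S\in\mathbb C^{n\times n}:\ \|A-S\|_F<\varepsilon\}\subset\mathcal G_\ell.$$
   Context: $\|\cdot\|_F$ is the Frobenius norm; $\mathfrak i$ is the imaginary unit; $I_k$ is the $k\times k$ identity; $\oplus$ is the block-diagonal direct sum, and a scalar denotes a $1\times1$ block. Blocks. For $k\ge1$, $\mu\in\mathbb C$: $J_k(\mu)$ is the $k\times k$ upper triangular Jordan block with eigenvalue $\mu$ (ones on the superdiagonal); $\Gamma_k$ is the $k\times k$ matrix whose entries in row $j$, columns $k-j+1$ and $k-j+2$ (the latter only if $j\ge2$) equal $(-1)^{k-j}$, for $j=1,\dots,k$, all other entries being $0$ (so $\Gamma_1=1$); $H_{2k}(\mu)=\begin{bmatrix}0&I_k\\ J_k(\mu)&0\end{bmatrix}$ is $2k\times2k$. Canonical form for congruence (CFC; known result of Horn and Sergeichuk). Every complex square matrix $A$ is congruent ($A\mapsto P^\top AP$, $P$ invertible) to a direct sum, unique up to permutation of summands, of blocks: Type 0, $J_k(0)$; Type I, $\Gamma_k$; Type II-(a), $H_{2k}(\mu)$ with $|\mu|>1$ or $\mu=e^{\mathfrak i\theta}$, $0<\theta<\pi$; Type II-(b), $H_{2k}((-1)^k)$. Canonical form for $^*$congruence ($^*$CFC; known result of Horn and Sergeichuk). Every complex square matrix is $^*$congruent ($A\mapsto P^*AP$, $P$ invertible) to a direct sum, unique up to permutation of summands, of blocks: Type 0, $J_k(0)$;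 Type I, $\alpha\Gamma_k$ with $|\alpha|=1$; Type II, $H_{2k}(\mu)$ with $|\mu|>1$. Congruence bundle. If the CFC of $A\in\mathbb C^{n\times n}$ is $\bigoplus_{j=1}^{n_1}J_{k_j}(0)\oplus\bigoplus_{j=1}^{n_2}\Gamma_{\ell_j}\oplus\bigoplus_{j=1}^{n_3}H_{2m_j}(\mu_j)\oplus\bigoplus_{j=1}^{n_4}H_{2p_j}((-1)^{p_j})$ (the third group being the Type II-(a) blocks), then $\mathcal B^c(A)$ is the set of all matrices $P\big(\bigoplus_{j=1}^{n_1}J_{k_j}(0)\oplus\bigoplus_{j=1}^{n_2}\Gamma_{\ell_j}\oplus\bigoplus_{j=1}^{n_3}H_{2m_j}(\widetilde\mu_j)\oplus\bigoplus_{j=1}^{n_4}H_{2p_j}((-1)^{p_j})\big)P^\top$ with $P\in\mathbb C^{n\times n}$ invertible, each $\widetilde\mu_j$ satisfying $|\widetilde\mu_j|>1$ or $\widetilde\mu_j=e^{\mathfrak i\widetilde\theta_j}$ with $0<\widetilde\theta_j<\pi$, and $\widetilde\mu_i\ne\widetilde\mu_j\Leftrightarrow\mu_i\neq\mu_j$ for all $i,j$. $^*$congruence bundle. If the $^*$CFC of $A\in\mathbb C^{n\times n}$ is $\bigoplus_{i=1}^{n_1}J_{k_i}(0)\oplus\bigoplus_{i=1}^{n_2}\alpha_i\Gamma_{\ell_i}\oplus\bigoplus_{i=1}^{n_3}H_{2m_i}(\mu_i)$, then $\mathcal B^*(A)$ is the set of all matrices $P\big(\bigoplus_{i=1}^{n_1}J_{k_i}(0)\oplus\bigoplus_{i=1}^{n_2}\widetilde\alpha_i\Gamma_{\ell_i}\oplus\bigoplus_{i=1}^{n_3}H_{2m_i}(\widetilde\mu_i)\big)P^*$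 with $P\in\mathbb C^{n\times n}$ invertible, $|\widetilde\alpha_i|=1$ for all $i$, $|\widetilde\mu_i|>1$ for all $i$, and, for all $i,j$: $\widetilde\alpha_i^2\ne\widetilde\alpha_j^2\Leftrightarrow\alpha_i^2\ne\alpha_j^2$ if $\ell_i\equiv\ell_j\pmod 2$; $\widetilde\alpha_i^2\ne-\widetilde\alpha_j^2\Leftrightarrow\alpha_i^2\ne-\alpha_j^2$ if $\ell_i\not\equiv\ell_j\pmod2$; and $\widetilde\mu_i\ne\widetilde\mu_j\Leftrightarrow\mu_i\ne\mu_j$. The bundles $\mathcal G$ and $\mathcal G_\ell$ do not depend on the particular values of the parameters $\mu_i,\alpha_j$ chosen subject to the stated constraints. *)

theory Defs
  imports
    Complex_Main
    "Jordan_Normal_Form.Jordan_Normal_Form"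
    "Jordan_Normal_Form.Schur_Decomposition"
begin

definition frobenius_norm :: "complex mat \<Rightarrow> real" where
  "frobenius_norm A = sqrt (\<Sum>i<dim_row A. \<Sum>j<dim_col A. (cmod (A $$ (i, j)))\<^sup>2)"

definition frobenius_ball :: "nat \<Rightarrow> complex mat \<Rightarrow> real \<Rightarrow> complex mat set" where
  "frobenius_ball n A \<epsilon> = {S \<in> carrier_mat n n. frobenius_norm (A - S) < \<epsilon>}"

definition open_mat_set :: "nat \<Rightarrow> complex mat set \<Rightarrow> bool" where
  "open_mat_set n G \<longleftrightarrow>
     G \<subseteq> carrier_mat n n \<and> (\<forall>A\<in>G. \<exists>\<epsilon>>0. frobenius_ball n A \<epsilon> \<subseteq> G)"

definition congruent_mat :: "complex mat \<Rightarrow> complex mat \<Rightarrow> bool" where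
  "congruent_mat A B \<longleftrightarrow> square_mat A \<and>
     (\<exists>P \<in> carrier_mat (dim_row A) (dim_row A). invertible_mat P \<and> B = transpose_mat P * A * P)"

definition star_congruent_mat :: "complex mat \<Rightarrow> complex mat \<Rightarrow> bool" where
  "star_congruent_mat A B \<longleftrightarrow> square_mat A \<and>
     (\<exists>P \<in> carrier_mat (dim_row A) (dim_row A). invertible_mat P \<and> B = mat_adjoint P * A * P)"

(* With indices starting at 1, row j has the entry (-1)^(k-j) in column k-j+1, and also in column
   k-j+2 if j >= 2. Below i = j - 1, and the bound on the column index makes the condition
   j >= 2 automatic. *)
definition Gamma_block :: "nat \<Rightarrow> complex mat" where
  "Gamma_block k =
     mat k k (\<lambda>(i, j). if i + j + 1 = k \<or> i + j = k then (- 1) ^ (k - 1 - i) else 0)"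

(* The argument k is half of the size: H_block k mu is the 2k x 2k matrix H_{2k}(mu). *)
definition H_block :: "nat \<Rightarrow> complex \<Rightarrow> complex mat" where
  "H_block k \<mu> = four_block_mat (0\<^sub>m k k) (1\<^sub>m k) (jordan_block k \<mu>) (0\<^sub>m k k)"

definition scalar_block :: "complex \<Rightarrow> complex mat" where
  "scalar_block c = mat 1 1 (\<lambda>_. c)"

definition typeIIa_param :: "complex \<Rightarrow> bool" where
  "typeIIa_param \<mu> \<longleftrightarrow> cmod \<mu> > 1 \<or> (\<exists>\<theta>. 0 < \<theta> \<and> \<theta> < pi \<and> \<mu> = exp (\<i> * complex_of_real \<theta>))"


subsection \<open>Congruence\<close>

definition cfc_mat ::
  "nat list \<Rightarrow> nat list \<Rightarrow> nat list \<Rightarrow> complex list \<Rightarrow> nat list \<Rightarrow> complex mat" where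
  "cfc_mat ks ls ms \<mu>s ps = diag_block_mat
     (map (\<lambda>k. jordan_block k 0) ks @
      map Gamma_block ls @
      map2 H_block ms \<mu>s @
      map (\<lambda>p. H_block p ((- 1) ^ p)) ps)"

definition is_cfc ::
  "complex mat \<Rightarrow> nat list \<Rightarrow> nat list \<Rightarrow> nat list \<Rightarrow> complex list \<Rightarrow> nat list \<Rightarrow> bool" where
  "is_cfc A ks ls ms \<mu>s ps \<longleftrightarrow>
     (\<forall>k \<in> set (ks @ ls @ ms @ ps). k \<ge> 1) \<and>
     length \<mu>s = length ms \<and> (\<forall>\<mu> \<in> set \<mu>s. typeIIa_param \<mu>) \<and>
     congruent_mat A (cfc_mat ks ls ms \<mu>s ps)"

(* The canonical form is unique only up to the order of the summands, so the union is taken over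
   all canonical forms of A. They all contribute the same set: permuting the summands of a
   canonical form is a congruence. *)
definition congruence_bundle :: "complex mat \<Rightarrow> complex mat set" where
  "congruence_bundle A =
     {P * cfc_mat ks ls ms \<nu>s ps * transpose_mat P | P ks ls ms \<mu>s \<nu>s ps.
        is_cfc A ks ls ms \<mu>s ps \<and>
        P \<in> carrier_mat (dim_row A) (dim_row A) \<and> invertible_mat P \<and>
        length \<nu>s = length ms \<and> (\<forall>\<nu> \<in> set \<nu>s. typeIIa_param \<nu>) \<and>
        (\<forall>i<length ms. \<forall>j<length ms. \<nu>s ! i \<noteq> \<nu>s ! j \<longleftrightarrow> \<mu>s ! i \<noteq> \<mu>s ! j)}"


subsection \<open>Star congruence\<close>

definition star_cfc_mat ::
  "nat list \<Rightarrow> nat list \<Rightarrow> complex list \<Rightarrow> nat list \<Rightarrow> complex list \<Rightarrow> complex mat" where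
  "star_cfc_mat ks ls \<alpha>s ms \<mu>s = diag_block_mat
     (map (\<lambda>k. jordan_block k 0) ks @
      map2 (\<lambda>l \<alpha>. \<alpha> \<cdot>\<^sub>m Gamma_block l) ls \<alpha>s @
      map2 H_block ms \<mu>s)"

definition is_star_cfc ::
  "complex mat \<Rightarrow> nat list \<Rightarrow> nat list \<Rightarrow> complex list \<Rightarrow> nat list \<Rightarrow> complex list \<Rightarrow> bool" where
  "is_star_cfc A ks ls \<alpha>s ms \<mu>s \<longleftrightarrow>
     (\<forall>k \<in> set (ks @ ls @ ms). k \<ge> 1) \<and>
     length \<alpha>s = length ls \<and> (\<forall>\<alpha> \<in> set \<alpha>s. cmod \<alpha> = 1) \<and>
     length \<mu>s = length ms \<and> (\<forall>\<mu> \<in> set \<mu>s. cmod \<mu> > 1) \<and>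
     star_congruent_mat A (star_cfc_mat ks ls \<alpha>s ms \<mu>s)"

definition star_congruence_bundle :: "complex mat \<Rightarrow> complex mat set" where
  "star_congruence_bundle A =
     {P * star_cfc_mat ks ls \<beta>s ms \<nu>s * mat_adjoint P | P ks ls \<alpha>s \<beta>s ms \<mu>s \<nu>s.
        is_star_cfc A ks ls \<alpha>s ms \<mu>s \<and>
        P \<in> carrier_mat (dim_row A) (dim_row A) \<and> invertible_mat P \<and>
        length \<beta>s = length ls \<and> (\<forall>\<beta> \<in> set \<beta>s. cmod \<beta> = 1) \<and>
        length \<nu>s = length ms \<and> (\<forall>\<nu> \<in> set \<nu>s. cmod \<nu> > 1) \<and>
        (\<forall>i<length ls. \<forall>j<length ls.
           (ls ! i mod 2 = ls ! j mod 2 \<longrightarrow>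
              ((\<beta>s ! i)\<^sup>2 \<noteq> (\<beta>s ! j)\<^sup>2 \<longleftrightarrow> (\<alpha>s ! i)\<^sup>2 \<noteq> (\<alpha>s ! j)\<^sup>2)) \<and>
           (ls ! i mod 2 \<noteq> ls ! j mod 2 \<longrightarrow>
              ((\<beta>s ! i)\<^sup>2 \<noteq> - (\<beta>s ! j)\<^sup>2 \<longleftrightarrow> (\<alpha>s ! i)\<^sup>2 \<noteq> - (\<alpha>s ! j)\<^sup>2))) \<and>
        (\<forall>i<length ms. \<forall>j<length ms. \<nu>s ! i \<noteq> \<nu>s ! j \<longleftrightarrow> \<mu>s ! i \<noteq> \<mu>s ! j)}"

end

theory Submission
  imports Defs
begin

text \<open>
  Let \<open>\<sigma>\<close> be the identity or complex conjugation and write \<open>B\<^sup>\<sigma>\<close> for the transpose or the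
  adjoint. Call \<open>B\<close> generic if it is invertible and \<open>det (x B\<^sup>\<sigma> - B)\<close> has \<open>n\<close> distinct roots. The
  roots are permuted by \<open>\<tau> x = 1 / \<sigma> x\<close>, and eigenvectors \<open>v\<close>, \<open>w\<close> of the pencil with
  eigenvalues \<open>\<lambda>\<close>, \<open>\<kappa>\<close> satisfy \<open>v\<^sup>\<sigma> B w = 0\<close> unless \<open>\<kappa> = \<tau> \<lambda>\<close>. Hence, in a rescaled
  eigenbasis, \<open>B\<close> is a direct sum of blocks \<open>H\<^sub>2(\<mu>)\<close>, one for each pair \<open>\<mu> \<noteq> \<tau> \<mu>\<close>, and of scalars,
  one for each root fixed by \<open>\<tau>\<close>; conversely every canonical form of a generic matrix has this
  shape. So each bundle consists of the generic matrices with a given number of fixed roots, and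
  this set is open: each simple root of \<open>B\<close> has exactly one root of a nearby matrix next to it, and
  this matching commutes with \<open>\<tau>\<close>.
\<close>

subsection \<open>Inverse matrices, pencils and their roots\<close>

text \<open>Canonical forms can jump under small perturbations, whereas the roots of the pencil move
  continuously; this is why the bundles are described by roots. The orthogonality of eigenvectors
  comes from using the eigenvector equation twice. For \<open>b(v,w) = v\<^sup>\<sigma> B w\<close>
  it reads \<open>b(v,w) = \<kappa> \<sigma>(b(w,v))\<close>, hence
  \<open>b(v,w) = \<kappa> \<sigma>(\<lambda>) b(v,w)\<close>. A simple root \<open>r\<close> fixed
  by \<tau> stays fixed: if \<open>s\<close> is the root of a nearby matrix next to
  \<open>r\<close>, then \<open>\<tau> s\<close> is a root of that matrix close to
  \<open>\<tau> r = r\<close>, and only one root is there, so \<open>\<tau> s = s\<close>. For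
  \<open>\<sigma> = id\<close> every scalar block has the root 1, so simplicity allows at most one
  such block and the parity of \<open>n\<close> decides whether it occurs. For conjugation the root
  of a scalar depends on its argument, many scalars can coexist, and their number tells the bundles
  for different values of the index apart.\<close>

lemma invertible_mat_iff_det:
  fixes A :: "complex mat"
  assumes A: "A \<in> carrier_mat n n"
  shows "invertible_mat A \<longleftrightarrow> det A \<noteq> 0"
proof
  assume "invertible_mat A"
  then obtain B where B: "A * B = 1\<^sub>m n" "B * A = 1\<^sub>m (dim_row B)"
    using A unfolding invertible_mat_def inverts_mat_def by auto
  have "B \<in> carrier_mat n n"
    using B A by (metis carrier_matD(2) carrier_mat_triv index_mult_mat(2,3) index_one_mat(2,3))
  with A B(1) have "det A * det B = 1" by (metis det_mult det_one)
  thus "det A \<noteq> 0" by auto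
next
  assume "det A \<noteq> 0"
  from det_non_zero_imp_unit[OF A this, of undefined] 
  obtain B where "B \<in> carrier_mat n n" "A * B = 1\<^sub>m n" "B * A = 1\<^sub>m n"
    unfolding Units_def ring_mat_def by auto
  thus "invertible_mat A" using A unfolding invertible_mat_def inverts_mat_def by auto
qed

lemma inverse_mat_exists:
  fixes A :: "complex mat"
  assumes A: "A \<in> carrier_mat n n" and d: "det A \<noteq> 0"
  obtains B where "B \<in> carrier_mat n n" "A * B = 1\<^sub>m n" "B * A = 1\<^sub>m n" "det B \<noteq> 0"
proof -
  from det_non_zero_imp_unit[OF A d, of undefined]
  obtain B where B: "B \<in> carrier_mat n n" "A * B = 1\<^sub>m n" "B * A = 1\<^sub>m n"
    unfolding Units_def ring_mat_def by auto
  hence "det A * det B = 1" using A by (metis det_mult det_one)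
  hence "det B \<noteq> 0" by auto
  with B that show thesis by blast
qed

lemma square_diag_block_mat_Cons:
  assumes "square_mat A" "\<forall>D\<in>set Ds. square_mat D"
  shows "diag_block_mat (A # Ds) =
    four_block_mat A (0\<^sub>m (dim_row A) (dim_row (diag_block_mat Ds)))
      (0\<^sub>m (dim_row (diag_block_mat Ds)) (dim_row A)) (diag_block_mat Ds)"
  using assms diag_block_mat_square[of Ds] by (auto simp: Let_def)

text \<open>\<open>U\<close> selects one eigenvalue from each pair \<open>{z, 1 / \<sigma> z}\<close>, namely the parameter of the block
  \<open>H\<^sub>2\<close>, and \<open>N\<close> describes the scalars admitted as \<open>1 \<times> 1\<close> blocks.\<close>

locale congruence_type =
  fixes \<sigma> :: "complex \<Rightarrow> complex" and U N :: "complex \<Rightarrow> bool"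
  assumes sigma_cases: "\<sigma> = id \<or> \<sigma> = cnj"
    and U_paired: "z \<noteq> 0 \<Longrightarrow> z * \<sigma> z \<noteq> 1 \<Longrightarrow> U (1 / \<sigma> z) \<longleftrightarrow> \<not> U z"
    and U_nonzero: "U z \<Longrightarrow> z \<noteq> 0"
    and U_not_fixed: "U z \<Longrightarrow> z * \<sigma> z \<noteq> 1"
    and N_nonzero: "N z \<Longrightarrow> z \<noteq> 0"
    and N_scaling: "c \<noteq> 0 \<Longrightarrow> \<exists>t. t \<noteq> 0 \<and> N (\<sigma> t * c * t)"
begin

lemma sigma_simps [simp]:
  "\<sigma> (x + y) = \<sigma> x + \<sigma> y" "\<sigma> (x - y) = \<sigma> x - \<sigma> y" "\<sigma> (- x) = - \<sigma> x"
  "\<sigma> (x * y) = \<sigma> x * \<sigma> y" "\<sigma> (x / y) = \<sigma> x / \<sigma> y" "\<sigma> (x ^ k) = \<sigma> x ^ k"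
  "\<sigma> 0 = 0" "\<sigma> 1 = 1" "\<sigma> (\<sigma> x) = x" "cmod (\<sigma> x) = cmod x"
  using sigma_cases by auto

lemma sigma_eq_0_iff [simp]: "\<sigma> x = 0 \<longleftrightarrow> x = 0"
  using sigma_cases by auto

lemma sigma_eq_iff [simp]: "\<sigma> x = \<sigma> y \<longleftrightarrow> x = y"
  using sigma_cases by auto

lemma sigma_sum: "\<sigma> (sum f S) = (\<Sum>x\<in>S. \<sigma> (f x))"
  using sigma_cases by auto

lemma sigma_prod: "\<sigma> (prod f S) = (\<Prod>x\<in>S. \<sigma> (f x))"
  using sigma_cases by auto

lemma sigma_of_int [simp]: "\<sigma> (of_int z) = of_int z"
  using sigma_cases by auto

lemma sigma_signof [simp]: "\<sigma> (signof p) = signof p"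
  using sigma_of_int[of "sign p"] by simp

lemma tendsto_sigma: "(f \<longlongrightarrow> l) F \<Longrightarrow> ((\<lambda>x. \<sigma> (f x)) \<longlongrightarrow> \<sigma> l) F"
  using sigma_cases by (auto intro: tendsto_cnj)

definition sadj :: "complex mat \<Rightarrow> complex mat" where
  "sadj A = mat (dim_col A) (dim_row A) (\<lambda>(i, j). \<sigma> (A $$ (j, i)))"

definition \<tau> :: "complex \<Rightarrow> complex" where
  "\<tau> z = 1 / \<sigma> z"

definition pencil :: "complex mat \<Rightarrow> complex \<Rightarrow> complex mat" where
  "pencil B x = mat (dim_row B) (dim_row B) (\<lambda>(i, j). x * \<sigma> (B $$ (j, i)) - B $$ (i, j))"

definition roots :: "complex mat \<Rightarrow> complex set" where
  "roots B = {x. det (pencil B x) = 0}"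

lemma tau_tau [simp]: "\<tau> (\<tau> z) = z"
  unfolding \<tau>_def by simp

lemma tau_fixed_iff: "z \<noteq> 0 \<Longrightarrow> \<tau> z = z \<longleftrightarrow> z * \<sigma> z = 1"
  by (simp add: \<tau>_def divide_eq_eq eq_commute[of 1])

lemma tau_eq_0_iff [simp]: "\<tau> z = 0 \<longleftrightarrow> z = 0"
  unfolding \<tau>_def by auto

lemma tau_eq_iff [simp]: "\<tau> z = \<tau> w \<longleftrightarrow> z = w"
  by (metis tau_tau)

lemma sadj_dim [simp]: "dim_row (sadj A) = dim_col A" "dim_col (sadj A) = dim_row A"
  unfolding sadj_def by auto

lemma sadj_carrier [simp]: "A \<in> carrier_mat n m \<Longrightarrow> sadj A \<in> carrier_mat m n"
  unfolding sadj_def by auto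

lemma sadj_index [simp]: "i < dim_col A \<Longrightarrow> j < dim_row A \<Longrightarrow> sadj A $$ (i, j) = \<sigma> (A $$ (j, i))"
  unfolding sadj_def by auto

lemma sadj_sadj [simp]: "sadj (sadj A) = A"
  by (rule eq_matI) auto

lemma sadj_one [simp]: "sadj (1\<^sub>m n) = 1\<^sub>m n"
  by (rule eq_matI) auto

lemma sadj_mult:
  assumes "A \<in> carrier_mat n k" "B \<in> carrier_mat k m"
  shows "sadj (A * B) = sadj B * sadj A"
  by (rule eq_matI) (use assms in \<open>auto simp: scalar_prod_def sigma_sum intro!: sum.cong\<close>)

lemma det_sadj:
  assumes A: "A \<in> carrier_mat n n"
  shows "det (sadj A) = \<sigma> (det A)"
proof -
  have "sadj A = transpose_mat (map_mat \<sigma> A)" by (rule eq_matI) auto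
  hence "det (sadj A) = det (map_mat \<sigma> A)" using A det_transpose[of "map_mat \<sigma> A" n] by simp
  also have "\<dots> = \<sigma> (det A)"
    using A by (auto simp: det_def' sigma_sum sigma_prod sigma_signof intro!: sum.cong prod.cong
        dest: permutes_in_image)
  finally show ?thesis .
qed

lemma pencil_carrier [simp]: "B \<in> carrier_mat n n \<Longrightarrow> pencil B x \<in> carrier_mat n n"
  unfolding pencil_def by auto

lemma pencil_index [simp]:
  "i < dim_row B \<Longrightarrow> j < dim_row B \<Longrightarrow> pencil B x $$ (i, j) = x * \<sigma> (B $$ (j, i)) - B $$ (i, j)"
  unfolding pencil_def by auto

lemma pencil_dim [simp]: "dim_row (pencil B x) = dim_row B" "dim_col (pencil B x) = dim_row B"
  unfolding pencil_def by auto

lemma pencil_eq: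
  assumes "B \<in> carrier_mat n n"
  shows "pencil B x = x \<cdot>\<^sub>m sadj B - B"
  by (rule eq_matI) (use assms in auto)

text \<open>Since \<open>sadj\<close> is an involution that reverses products, \<open>B\<close> and
  \<open>sadj B\<close> are transformed by the same pair \<open>sadj P\<close>, \<open>P\<close>.
  This makes the roots invariant under congruence.\<close>

lemma pencil_congruence:
  assumes B: "B \<in> carrier_mat n n" and P: "P \<in> carrier_mat n n"
  shows "pencil (sadj P * B * P) x = sadj P * pencil B x * P"
proof -
  have "sadj (sadj P * B * P) = sadj P * sadj B * P"
    using sadj_mult[OF mult_carrier_mat[OF sadj_carrier[OF P] B] P] sadj_mult[OF sadj_carrier[OF P] B]
      assoc_mult_mat[OF sadj_carrier[OF P] sadj_carrier[OF B] P] by simp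
  moreover have "sadj P * (x \<cdot>\<^sub>m sadj B - B) * P = x \<cdot>\<^sub>m (sadj P * sadj B * P) - sadj P * B * P"
  proof -
    have P': "sadj P \<in> carrier_mat n n" and B': "sadj B \<in> carrier_mat n n"
      using P B by auto
    have xB: "x \<cdot>\<^sub>m sadj B \<in> carrier_mat n n" using B' by simp
    have "sadj P * (x \<cdot>\<^sub>m sadj B - B) * P = (sadj P * (x \<cdot>\<^sub>m sadj B) - sadj P * B) * P"
      using mult_minus_distrib_mat[OF P' xB B] by simp
    also have "\<dots> = sadj P * (x \<cdot>\<^sub>m sadj B) * P - sadj P * B * P"
      by (rule minus_mult_distrib_mat[OF mult_carrier_mat[OF P' xB] mult_carrier_mat[OF P' B] P])
    also have "sadj P * (x \<cdot>\<^sub>m sadj B) * P = x \<cdot>\<^sub>m (sadj P * sadj B * P)"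
      using mult_smult_distrib[OF P' B', of x] mult_smult_assoc_mat[OF mult_carrier_mat[OF P' B'] P, of x]
      by simp
    finally show ?thesis .
  qed
  ultimately show ?thesis
    using pencil_eq[OF B] pencil_eq[OF mult_carrier_mat[OF mult_carrier_mat[OF sadj_carrier[OF P] B] P]]
    by simp
qed

lemma det_congruence:
  assumes "B \<in> carrier_mat n n" "P \<in> carrier_mat n n"
  shows "det (sadj P * B * P) = \<sigma> (det P) * det B * det P"
  using assms det_mult[OF mult_carrier_mat[OF sadj_carrier[OF assms(2)] assms(1)] assms(2)]
    det_mult[OF sadj_carrier[OF assms(2)] assms(1)] by (simp add: det_sadj[of P n])

lemma roots_congruence:
  assumes B: "B \<in> carrier_mat n n" and P: "P \<in> carrier_mat n n" and "det P \<noteq> 0"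
  shows "roots (sadj P * B * P) = roots B"
  using assms det_congruence[OF pencil_carrier[OF B] P]
  unfolding roots_def pencil_congruence[OF B P] by auto

lemma pencil_four_block_diag:
  assumes A: "A \<in> carrier_mat n n" and B: "B \<in> carrier_mat m m"
  shows "pencil (four_block_mat A (0\<^sub>m n m) (0\<^sub>m m n) B) x =
    four_block_mat (pencil A x) (0\<^sub>m n m) (0\<^sub>m m n) (pencil B x)"
  by (rule eq_matI) (use A B in auto)

lemma roots_diag_block_mat:
  assumes "\<forall>D\<in>set Ds. square_mat D"
  shows "roots (diag_block_mat Ds) = (\<Union>D\<in>set Ds. roots D)"
  using assms
proof (induction Ds)
  case Nil
  show ?case unfolding roots_def by (auto simp: pencil_def)
next
  case (Cons A Ds)
  let ?B = "diag_block_mat Ds"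
  have sq: "square_mat A" "\<forall>D\<in>set Ds. square_mat D" using Cons.prems by simp_all
  have A: "A \<in> carrier_mat (dim_row A) (dim_row A)" using Cons.prems by auto
  have B: "?B \<in> carrier_mat (dim_row ?B) (dim_row ?B)"
    using Cons.prems diag_block_mat_square[of Ds] by auto
  have "roots (diag_block_mat (A # Ds)) = roots A \<union> roots ?B"
    unfolding square_diag_block_mat_Cons[OF sq] roots_def pencil_four_block_diag[OF A B]
      det_four_block_mat_lower_left_zero[OF pencil_carrier[OF A] zero_carrier_mat refl
        pencil_carrier[OF B]] mult_eq_0_iff Collect_disj_eq ..
  with Cons show ?case by simp
qed

lemma det_diag_block_mat_nonzero:
  assumes "\<forall>D\<in>set Ds. square_mat D"
  shows "det (diag_block_mat Ds) \<noteq> 0 \<longleftrightarrow> (\<forall>D\<in>set Ds. det D \<noteq> (0 :: complex))"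
  using assms
proof (induction Ds)
  case (Cons A Ds)
  let ?B = "diag_block_mat Ds"
  have sq: "square_mat A" "\<forall>D\<in>set Ds. square_mat D" using Cons.prems by simp_all
  have A: "A \<in> carrier_mat (dim_row A) (dim_row A)" using Cons.prems by auto
  have B: "?B \<in> carrier_mat (dim_row ?B) (dim_row ?B)"
    using Cons.prems diag_block_mat_square[of Ds] by auto
  have "det (diag_block_mat (A # Ds)) = det A * det ?B"
    unfolding square_diag_block_mat_Cons[OF sq]
      det_four_block_mat_lower_left_zero[OF A zero_carrier_mat refl B] ..
  with Cons show ?case by simp
qed simp

end

subsection \<open>Generic matrices form an open set\<close>

context congruence_type begin

text \<open>Factoring out \<open>sadj B\<close> leaves \<open>x I - M\<close>, where
  \<open>M\<close> is the cosquare \<open>(sadj B)\<^sup>-\<^sup>1 B\<close>; its characteristic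
  polynomial splits over the complex numbers. The list \<open>as\<close> carries multiplicities,
  which the later estimate of the determinant needs.\<close>

lemma pencil_factorization:
  assumes B: "B \<in> carrier_mat n n" and d: "det B \<noteq> 0"
  obtains as where "length as = n" "\<And>x. det (pencil B x) = \<sigma> (det B) * (\<Prod>a\<leftarrow>as. x - a)"
proof -
  have B': "sadj B \<in> carrier_mat n n" using B by simp
  obtain C where C: "C \<in> carrier_mat n n" "sadj B * C = 1\<^sub>m n"
    using inverse_mat_exists[OF B'] d det_sadj[OF B] by auto
  define M where "M = C * B"
  have M: "M \<in> carrier_mat n n" using C B unfolding M_def by auto
  have BM: "sadj B * M = B"
    unfolding M_def using B C by (simp flip: assoc_mult_mat[OF B' C(1) B])
  obtain as where as: "char_poly M = (\<Prod>a\<leftarrow>as. [:- a, 1:])" "length as = n"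
    using char_poly_factorized[OF M] by blast
  have "det (pencil B x) = \<sigma> (det B) * (\<Prod>a\<leftarrow>as. x - a)" for x
  proof -
    have "pencil B x = sadj B * (x \<cdot>\<^sub>m 1\<^sub>m n - M)"
      using B' M BM mult_minus_distrib_mat[OF B' smult_carrier_mat[OF one_carrier_mat] M, of x]
        mult_smult_distrib[OF B' one_carrier_mat, of x]
      by (simp add: pencil_eq[OF B] right_mult_one_mat[OF B'])
    moreover have "x \<cdot>\<^sub>m 1\<^sub>m n - M = - char_matrix M x"
      by (rule eq_matI) (use M in \<open>auto simp: char_matrix_def\<close>)
    ultimately have "det (pencil B x) = \<sigma> (det B) * poly (char_poly M) x"
      using M B det_mult[OF B', of "- char_matrix M x"] char_poly_matrix[OF M, of x] det_sadj[OF B]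
      by simp
    also have "poly (char_poly M) x = (\<Prod>a\<leftarrow>as. x - a)"
      unfolding as(1) by (induction as) (auto simp: algebra_simps)
    finally show ?thesis .
  qed
  with as(2) that show thesis by blast
qed

lemma finite_card_roots:
  assumes "B \<in> carrier_mat n n" "det B \<noteq> 0"
  shows "finite (roots B)" "card (roots B) \<le> n"
proof -
  obtain as where as: "length as = n" "\<And>x. det (pencil B x) = \<sigma> (det B) * (\<Prod>a\<leftarrow>as. x - a)"
    using pencil_factorization[OF assms] by blast
  have "roots B = set as"
    unfolding roots_def as(2) using assms(2) by (auto simp: prod_list_zero_iff)
  thus "finite (roots B)" "card (roots B) \<le> n" using as(1) card_length[of as] by auto
qed

lemma roots_nonzero:
  assumes B: "B \<in> carrier_mat n n" "det B \<noteq> 0" and x: "x \<in> roots B"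
  shows "x \<noteq> 0"
proof
  assume "x = 0"
  moreover have "pencil B 0 = (- 1) \<cdot>\<^sub>m B" by (rule eq_matI) (use B in auto)
  ultimately show False using x B unfolding roots_def by simp
qed

text \<open>The \<open>sadj\<close> of the pencil at \<open>x\<close> is the pencil at
  \<open>\<tau> x\<close> times the nonzero factor \<open>- \<sigma> x\<close>, so both are singular
  together.\<close>

lemma tau_roots:
  assumes B: "B \<in> carrier_mat n n" "det B \<noteq> 0" and x: "x \<in> roots B"
  shows "\<tau> x \<in> roots B"
proof -
  have "x \<noteq> 0" using roots_nonzero[OF assms] .
  hence "sadj (pencil B x) = (- \<sigma> x) \<cdot>\<^sub>m pencil B (\<tau> x)"
    by (intro eq_matI) (use B in \<open>auto simp: \<tau>_def field_simps\<close>)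
  moreover have "det (sadj (pencil B x)) = 0"
    using x B unfolding roots_def by (simp add: det_sadj[OF pencil_carrier])
  ultimately show ?thesis using \<open>x \<noteq> 0\<close> unfolding roots_def by simp
qed

definition generic :: "nat \<Rightarrow> nat \<Rightarrow> complex mat \<Rightarrow> bool" where
  "generic n m B \<longleftrightarrow> B \<in> carrier_mat n n \<and> det B \<noteq> 0 \<and> card (roots B) = n \<and>
     card {x \<in> roots B. \<tau> x = x} = m"

lemma generic_congruence:
  assumes "generic n m B" "P \<in> carrier_mat n n" "det P \<noteq> 0"
  shows "generic n m (sadj P * B * P)"
proof -
  have B: "B \<in> carrier_mat n n" using assms(1) unfolding generic_def by simp
  have "sadj P * B * P \<in> carrier_mat n n"
    using B assms(2) by (meson mult_carrier_mat sadj_carrier)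
  thus ?thesis
    using assms roots_congruence[OF B assms(2,3)] det_congruence[OF B assms(2)]
    unfolding generic_def by auto
qed

end

section \<open>Neighbourhoods in the Frobenius norm and limits of determinants\<close>

lemma norm_entry_le_frobenius_norm:
  assumes "i < dim_row A" "j < dim_col A"
  shows "cmod (A $$ (i, j)) \<le> frobenius_norm A"
  unfolding frobenius_norm_def
proof (rule real_le_rsqrt)
  have "(cmod (A $$ (i, j)))\<^sup>2 \<le> (\<Sum>j<dim_col A. (cmod (A $$ (i, j)))\<^sup>2)"
    by (rule member_le_sum) (use assms in auto)
  also have "\<dots> \<le> (\<Sum>i<dim_row A. \<Sum>j<dim_col A. (cmod (A $$ (i, j)))\<^sup>2)"
    by (rule member_le_sum[of i _ "\<lambda>i. \<Sum>j<dim_col A. (cmod (A $$ (i, j)))\<^sup>2"])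
      (use assms in \<open>auto intro: sum_nonneg\<close>)
  finally show "(cmod (A $$ (i, j)))\<^sup>2 \<le> (\<Sum>i<dim_row A. \<Sum>j<dim_col A. (cmod (A $$ (i, j)))\<^sup>2)" .
qed

text \<open>As a filter, the balls become accessible to the limit laws for sums and products. The
  principal filter fixes the size, because the matrix type contains matrices of all sizes.\<close>

definition frobenius_nhds :: "nat \<Rightarrow> complex mat \<Rightarrow> complex mat filter" where
  "frobenius_nhds n A =
     inf (filtercomap (\<lambda>S. frobenius_norm (A - S)) (nhds 0)) (principal (carrier_mat n n))"

lemma eventually_frobenius_nhds:
  "eventually P (frobenius_nhds n A) \<longleftrightarrow> (\<exists>\<epsilon>>0. \<forall>S\<in>frobenius_ball n A \<epsilon>. P S)"
proof
  assume "eventually P (frobenius_nhds n A)"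
  then obtain Q where Q: "eventually Q (nhds 0)"
    "\<And>S. Q (frobenius_norm (A - S)) \<Longrightarrow> S \<in> carrier_mat n n \<Longrightarrow> P S"
    unfolding frobenius_nhds_def eventually_inf_principal eventually_filtercomap by auto
  then obtain d where "d > 0" "\<And>x. dist x 0 < d \<Longrightarrow> Q x"
    unfolding eventually_nhds_metric by auto
  moreover have "frobenius_norm B \<ge> 0" for B
    unfolding frobenius_norm_def by (intro real_sqrt_ge_zero sum_nonneg) auto
  ultimately show "\<exists>\<epsilon>>0. \<forall>S\<in>frobenius_ball n A \<epsilon>. P S"
    using Q(2) unfolding frobenius_ball_def by (intro exI[of _ d]) auto
next
  assume "\<exists>\<epsilon>>0. \<forall>S\<in>frobenius_ball n A \<epsilon>. P S"
  then obtain e where e: "e > 0" "\<And>S. S \<in> frobenius_ball n A e \<Longrightarrow> P S" by auto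
  have "eventually (\<lambda>x. x < e) (nhds (0 :: real))"
    using order_tendstoD(2)[OF filterlim_ident e(1)] .
  thus "eventually P (frobenius_nhds n A)"
    using e(2) unfolding frobenius_nhds_def eventually_inf_principal eventually_filtercomap
    by (auto simp: frobenius_ball_def)
qed

lemma tendsto_entry:
  assumes A: "A \<in> carrier_mat n n" and ij: "i < n" "j < n"
  shows "((\<lambda>S. S $$ (i, j)) \<longlongrightarrow> A $$ (i, j)) (frobenius_nhds n A)"
proof (rule metric_tendsto_imp_tendsto)
  show "((\<lambda>S. frobenius_norm (A - S)) \<longlongrightarrow> 0) (frobenius_nhds n A)"
    unfolding frobenius_nhds_def by (rule filterlim_mono[OF filterlim_filtercomap]) auto
  show "\<forall>\<^sub>F S in frobenius_nhds n A. dist (S $$ (i, j)) (A $$ (i, j)) \<le> dist (frobenius_norm (A - S)) 0"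
    unfolding frobenius_nhds_def eventually_inf_principal
  proof (intro always_eventually allI impI)
    fix S :: "complex mat"
    assume "S \<in> carrier_mat n n"
    thus "dist (S $$ (i, j)) (A $$ (i, j)) \<le> dist (frobenius_norm (A - S)) 0"
      using norm_entry_le_frobenius_norm[of i "A - S" j] A ij
      by (auto simp: dist_norm norm_minus_commute)
  qed
qed

text \<open>By the Leibniz formula the determinant is one fixed polynomial in the entries as long as
  the size is constant.\<close>

lemma tendsto_det:
  fixes f :: "'a \<Rightarrow> complex mat"
  assumes L: "L \<in> carrier_mat n n" and f: "\<forall>\<^sub>F x in F. f x \<in> carrier_mat n n"
    and lim: "\<And>i j. i < n \<Longrightarrow> j < n \<Longrightarrow> ((\<lambda>x. f x $$ (i, j)) \<longlongrightarrow> L $$ (i, j)) F"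
  shows "((\<lambda>x. det (f x)) \<longlongrightarrow> det L) F"
proof (rule Lim_transform_eventually)
  show "((\<lambda>x. \<Sum>p\<in>{p. p permutes {0..<n}}. signof p * (\<Prod>i=0..<n. f x $$ (i, p i))) \<longlongrightarrow> det L) F"
    unfolding det_def'[OF L]
    by (intro tendsto_sum tendsto_mult tendsto_const tendsto_prod lim)
      (auto dest: permutes_in_image)
  show "\<forall>\<^sub>F x in F. (\<Sum>p\<in>{p. p permutes {0..<n}}. signof p * (\<Prod>i=0..<n. f x $$ (i, p i))) = det (f x)"
    using f by eventually_elim (simp add: det_def')
qed

text \<open>Two radii are needed: points are matched within \<delta>, and continuity turns \<delta>
  into \<eta> after applying \<open>t\<close>. Separation makes the matching injective, and the
  bound on \<open>card S\<close> makes it surjective, so \<open>S\<close> has no stray points. Since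
  \<open>t\<close> maps the partner of \<open>r\<close> into \<open>S\<close> and close to
  \<open>t r\<close>, it maps it to the partner of \<open>t r\<close>.\<close>

lemma card_fixed_points_perturbation:
  fixes R S :: "'a :: metric_space set"
  assumes fin: "finite S" "card S \<le> card R" and R: "finite R"
    and tR: "\<And>r. r \<in> R \<Longrightarrow> t r \<in> R" and tS: "\<And>s. s \<in> S \<Longrightarrow> t s \<in> S"
    and near: "\<And>r. r \<in> R \<Longrightarrow> \<exists>s\<in>S. dist s r < \<delta>"
    and le: "\<delta> \<le> \<eta>"
    and sep: "\<And>r r'. r \<in> R \<Longrightarrow> r' \<in> R \<Longrightarrow> r \<noteq> r' \<Longrightarrow> 2 * \<eta> \<le> dist r r'"
    and cont: "\<And>r s. r \<in> R \<Longrightarrow> dist s r < \<delta> \<Longrightarrow> dist (t s) (t r) < \<eta>"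
  shows "card S = card R \<and> card {s \<in> S. t s = s} = card {r \<in> R. t r = r}"
proof -
  \<comment> \<open>\<open>f\<close> is a bijection from \<open>R\<close> onto \<open>S\<close> commuting with \<open>t\<close>.\<close>
  obtain f where f: "\<And>r. r \<in> R \<Longrightarrow> f r \<in> S" "\<And>r. r \<in> R \<Longrightarrow> dist (f r) r < \<delta>"
    using near by metis
  \<comment> \<open>No point \<open>s\<close> is within \<eta> of two points of \<open>R\<close>,
    because these are at least \<open>2 * \<eta>\<close> apart.\<close>
  have same: "r = r'" if "r \<in> R" "r' \<in> R" "dist s r < \<eta>" "dist s r' < \<eta>" for s r r'
    using sep[of r r'] that dist_triangle2[of r r' s] by (force simp: dist_commute)
  have inj: "inj_on f R"
  proof (rule inj_onI)
    fix r r' assume "r \<in> R" "r' \<in> R" "f r = f r'"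
    thus "r = r'" using same[of r r' "f r"] f(2)[of r] f(2)[of r'] le by auto
  qed
  have S: "f ` R = S"
    using card_seteq[OF fin(1), of "f ` R"] f(1) fin(2) card_image[OF inj] by auto
  have comm: "t (f r) = f (t r)" if r: "r \<in> R" for r
  proof -
    have "t (f r) \<in> f ` R" using tS f(1) r S by auto
    then obtain r' where r': "r' \<in> R" "t (f r) = f r'" by auto
    have "r' = t r"
      using same[OF r'(1) tR[OF r], of "t (f r)"] cont[OF r f(2)[OF r]] f(2)[OF r'(1)] r'(2) le by auto
    with r' show ?thesis by simp
  qed
  have "{s \<in> S. t s = s} = f ` {r \<in> R. t r = r}"
  proof -
    have "t (f r) = f r \<longleftrightarrow> t r = r" if "r \<in> R" for r
      using comm[OF that] inj_on_eq_iff[OF inj tR[OF that] that] by simp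
    thus ?thesis unfolding S[symmetric] by blast
  qed
  moreover have "inj_on f {r \<in> R. t r = r}" using inj by (rule inj_on_subset) auto
  ultimately have "card {s \<in> S. t s = s} = card {r \<in> R. t r = r}"
    by (simp only: card_image)
  moreover have "card S = card R" using card_image[OF inj] unfolding S .
  ultimately show ?thesis by blast
qed

section \<open>Continuity of the roots and openness\<close>

context congruence_type begin

lemma isCont_tau: "z \<noteq> 0 \<Longrightarrow> isCont \<tau> z"
  unfolding \<tau>_def isCont_def using tendsto_sigma[OF tendsto_ident_at, of z UNIV]
  by (intro tendsto_divide tendsto_const) auto

text \<open>At a root \<open>r\<close> of \<open>B\<close> the determinant of the pencil of
  \<open>S\<close> tends to 0, while \<open>cmod (det S) * \<delta> ^ n\<close> tends to a positive
  number. So the former is eventually the smaller one, which is impossible if \<open>S\<close> has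
  no root near \<open>r\<close>.\<close>

lemma eventually_root_near:
  assumes B: "B \<in> carrier_mat n n" "det B \<noteq> 0" and r: "r \<in> roots B" and \<delta>: "\<delta> > 0"
  shows "\<forall>\<^sub>F S in frobenius_nhds n B. \<exists>s\<in>roots S. dist s r < \<delta>"
proof -
  let ?F = "frobenius_nhds n B"
  have carrier: "\<forall>\<^sub>F S in ?F. S \<in> carrier_mat n n"
    unfolding frobenius_nhds_def by (simp add: eventually_inf_principal)
  have detS: "((\<lambda>S. det S) \<longlongrightarrow> det B) ?F"
    using B by (intro tendsto_det[where n = n] carrier tendsto_entry) auto
  have "((\<lambda>S. pencil S r $$ (i, j)) \<longlongrightarrow> pencil B r $$ (i, j)) ?F" if ij: "i < n" "j < n" for i j
  proof (rule Lim_transform_eventually)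
    show "((\<lambda>S. r * \<sigma> (S $$ (j, i)) - S $$ (i, j)) \<longlongrightarrow> pencil B r $$ (i, j)) ?F"
      using B ij by (auto intro!: tendsto_intros tendsto_sigma tendsto_entry)
    show "\<forall>\<^sub>F S in ?F. r * \<sigma> (S $$ (j, i)) - S $$ (i, j) = pencil S r $$ (i, j)"
      using carrier by eventually_elim (use ij in auto)
  qed
  hence "((\<lambda>S. det (pencil S r)) \<longlongrightarrow> det (pencil B r)) ?F"
    using B carrier by (intro tendsto_det[where n = n]) (auto elim: eventually_mono)
  hence "((\<lambda>S. cmod (det (pencil S r)) - cmod (det S) * \<delta> ^ n) \<longlongrightarrow> 0 - cmod (det B) * \<delta> ^ n) ?F"
    using r unfolding roots_def by (intro tendsto_intros detS) (auto dest: tendsto_norm)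
  moreover have "0 - cmod (det B) * \<delta> ^ n < 0" using B \<delta> by simp
  ultimately have "\<forall>\<^sub>F S in ?F. cmod (det (pencil S r)) - cmod (det S) * \<delta> ^ n < 0"
    by (rule order_tendstoD)
  moreover have "\<forall>\<^sub>F S in ?F. det S \<noteq> 0"
    using tendsto_imp_eventually_ne[OF detS B(2)] .
  ultimately show ?thesis
    using carrier
  proof eventually_elim
    case (elim S)
    obtain as where as: "length as = n" "\<And>x. det (pencil S x) = \<sigma> (det S) * (\<Prod>a\<leftarrow>as. x - a)"
      using pencil_factorization[OF elim(3,2)] by blast
    \<comment> \<open>If all roots of \<open>S\<close> are at distance at least \<open>\<delta>\<close> from \<open>r\<close>, the factorization makes the
      determinant large at \<open>r\<close>.\<close>
    show ?case
    proof (rule ccontr)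
      assume far: "\<not> (\<exists>s\<in>roots S. dist s r < \<delta>)"
      have "a \<in> roots S" if "a \<in> set as" for a
        using that unfolding roots_def as(2) by (auto simp: prod_list_zero_iff)
      hence "\<forall>a\<in>set as. cmod (r - a) \<ge> \<delta>"
        using far by (auto simp: dist_norm norm_minus_commute not_less)
      hence "\<delta> ^ length as \<le> cmod (\<Prod>a\<leftarrow>as. r - a)"
        using \<delta> by (induction as) (auto simp: norm_mult intro!: mult_mono)
      hence "cmod (det S) * \<delta> ^ n \<le> cmod (det (pencil S r))"
        unfolding as by (simp add: norm_mult mult_left_mono as(1))
      thus False using elim(1) by simp
    qed
  qed
qed

lemma generic_open:
  assumes gen: "generic n m B"
  shows "\<exists>\<epsilon>>0. \<forall>S\<in>frobenius_ball n B \<epsilon>. generic n m S"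
proof -
  let ?F = "frobenius_nhds n B" and ?R = "roots B"
  have B: "B \<in> carrier_mat n n" "det B \<noteq> 0" and card: "card ?R = n" "card {x \<in> ?R. \<tau> x = x} = m"
    using gen unfolding generic_def by auto
  note fin = finite_card_roots(1)[OF B]
  \<comment> \<open>The filter \<open>at_right 0\<close> collects finitely many smallness conditions
    at once, also when there is no pair of different roots whose distance could bound
    \<eta>.\<close>
  have "\<forall>\<^sub>F \<eta> in at_right 0. \<forall>r\<in>?R. \<forall>r'\<in>?R. r \<noteq> r' \<longrightarrow> 2 * \<eta> \<le> dist r r'"
  proof (intro eventually_ball_finite fin ballI)
    fix r r'
    show "\<forall>\<^sub>F \<eta> in at_right 0. r \<noteq> r' \<longrightarrow> 2 * \<eta> \<le> dist r r'"
    proof (cases "r = r'")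
      case False
      thus ?thesis
        unfolding eventually_at_right_field by (intro exI[of _ "dist r r' / 2"]) auto
    qed simp
  qed
  hence "\<forall>\<^sub>F \<eta> in at_right 0. \<eta> > 0 \<and> (\<forall>r\<in>?R. \<forall>r'\<in>?R. r \<noteq> r' \<longrightarrow> 2 * \<eta> \<le> dist r r')"
    using eventually_at_right_less by (rule eventually_elim2) auto
  then obtain \<eta> :: real where \<eta>: "\<eta> > 0" "\<And>r r'. r \<in> ?R \<Longrightarrow> r' \<in> ?R \<Longrightarrow> r \<noteq> r' \<Longrightarrow> 2 * \<eta> \<le> dist r r'"
    using eventually_happens'[OF trivial_limit_at_right_real] by blast
  \<comment> \<open>\<delta> is chosen after \<eta>, from the continuity of \<tau> at the finitely
    many roots, all of which are nonzero.\<close>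
  have "\<forall>\<^sub>F \<delta> in at_right 0. \<forall>r\<in>?R. \<forall>s. dist s r < \<delta> \<longrightarrow> dist (\<tau> s) (\<tau> r) < \<eta>"
  proof (intro eventually_ball_finite fin ballI)
    fix r assume "r \<in> ?R"
    hence "isCont \<tau> r" using roots_nonzero[OF B] isCont_tau by blast
    then obtain d where "d > 0" "\<And>s. s \<noteq> r \<Longrightarrow> dist s r < d \<Longrightarrow> dist (\<tau> s) (\<tau> r) < \<eta>"
      using \<eta>(1) unfolding isCont_def LIM_def by blast
    hence "d > 0" "\<And>s. dist s r < d \<Longrightarrow> dist (\<tau> s) (\<tau> r) < \<eta>"
      using \<eta>(1) by (metis dist_self)+
    thus "\<forall>\<^sub>F \<delta> in at_right 0. \<forall>s. dist s r < \<delta> \<longrightarrow> dist (\<tau> s) (\<tau> r) < \<eta>"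
      unfolding eventually_at_right_field by (intro exI[of _ d]) auto
  qed
  hence "\<forall>\<^sub>F \<delta> in at_right 0. (\<delta> > 0 \<and> \<delta> \<le> \<eta>) \<and> (\<forall>r\<in>?R. \<forall>s. dist s r < \<delta> \<longrightarrow> dist (\<tau> s) (\<tau> r) < \<eta>)"
    using \<eta>(1) by (intro eventually_conj) (auto simp: eventually_at_right_field intro!: exI[of _ \<eta>])
  then obtain \<delta> :: real where \<delta>: "\<delta> > 0" "\<delta> \<le> \<eta>"
      "\<And>r s. r \<in> ?R \<Longrightarrow> dist s r < \<delta> \<Longrightarrow> dist (\<tau> s) (\<tau> r) < \<eta>"
    using eventually_happens'[OF trivial_limit_at_right_real] by blast
  have near: "\<forall>\<^sub>F S in ?F. \<forall>r\<in>?R. \<exists>s\<in>roots S. dist s r < \<delta>"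
    using eventually_root_near[OF B _ \<delta>(1)] fin by (intro eventually_ball_finite) auto
  have carrier: "\<forall>\<^sub>F S in ?F. S \<in> carrier_mat n n"
    unfolding frobenius_nhds_def by (simp add: eventually_inf_principal)
  have detS: "((\<lambda>S. det S) \<longlongrightarrow> det B) ?F"
    using B by (intro tendsto_det[where n = n] carrier tendsto_entry) auto
  have "\<forall>\<^sub>F S in ?F. det S \<noteq> 0"
    using tendsto_imp_eventually_ne[OF detS B(2)] .
  hence "\<forall>\<^sub>F S in ?F. generic n m S"
    using near carrier
  proof eventually_elim
    case (elim S)
    have "card (roots S) = card ?R \<and> card {s \<in> roots S. \<tau> s = s} = card {r \<in> ?R. \<tau> r = r}"
      using finite_card_roots[OF elim(3,1)] card tau_roots[OF B] tau_roots[OF elim(3,1)] elim(2) \<eta>(2) \<delta> fin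
      by (intro card_fixed_points_perturbation[where \<delta> = \<delta> and \<eta> = \<eta>]) auto
    thus ?case using elim card unfolding generic_def by simp
  qed
  thus ?thesis unfolding eventually_frobenius_nhds .
qed

end

subsection \<open>Generic canonical forms\<close>

context congruence_type begin

text \<open>The pencil has zero diagonal blocks and triangular off-diagonal blocks, with diagonal
  entries \<open>x * \<sigma> \<mu> - 1\<close> and \<open>x - \<mu>\<close>. Its determinant is, up
  to sign, the product of the determinants of these two.\<close>

lemma roots_H_block:
  assumes k: "k \<ge> 1" and mu: "\<mu> \<noteq> 0"
  shows "roots (H_block k \<mu>) = {\<mu>, \<tau> \<mu>}"
proof -
  have "x \<in> roots (H_block k \<mu>) \<longleftrightarrow> x = \<mu> \<or> x = \<tau> \<mu>" for x
  proof -
    define X where "X = mat k k (\<lambda>(i, j). x * \<sigma> (jordan_block k \<mu> $$ (j, i)) - (if i = j then 1 else 0))"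
    define Y where "Y = mat k k (\<lambda>(i, j). (if i = j then x else 0) - jordan_block k \<mu> $$ (i, j))"
    have XY: "X \<in> carrier_mat k k" "Y \<in> carrier_mat k k" unfolding X_def Y_def by auto
    have "pencil (H_block k \<mu>) x = four_block_mat (0\<^sub>m k k) X Y (0\<^sub>m k k)"
      by (rule eq_matI) (auto simp: H_block_def X_def Y_def)
    hence "det (pencil (H_block k \<mu>) x) = det (0\<^sub>m k k * 0\<^sub>m k k - X * Y)"
      using det_four_block_mat[OF zero_carrier_mat XY zero_carrier_mat] XY by simp
    also have "0\<^sub>m k k * 0\<^sub>m k k - X * Y = (- 1) \<cdot>\<^sub>m (X * Y)"
      using XY by (intro eq_matI) auto
    also have "det \<dots> = (- 1) ^ k * (det X * det Y)"
      using XY by (simp add: det_mult)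
    also have "det X = (x * \<sigma> \<mu> - 1) ^ k"
      by (subst det_lower_triangular[OF _ XY(1)])
        (auto simp: X_def jordan_block_def prod_list_diag_prod)
    also have "det Y = (x - \<mu>) ^ k"
      by (subst det_upper_triangular[OF _ XY(2)])
        (auto simp: Y_def jordan_block_def prod_list_diag_prod upper_triangular_def)
    finally show ?thesis
      using k mu unfolding roots_def \<tau>_def by (auto simp: field_simps)
  qed
  thus ?thesis by blast
qed

lemma roots_Gamma_block:
  assumes a: "\<alpha> \<noteq> 0"
  shows "roots (\<alpha> \<cdot>\<^sub>m Gamma_block k) \<subseteq> {(- 1) ^ (k - 1) * (\<alpha> / \<sigma> \<alpha>)}"
proof
  fix x assume x: "x \<in> roots (\<alpha> \<cdot>\<^sub>m Gamma_block k)"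
  define M where "M = pencil (\<alpha> \<cdot>\<^sub>m Gamma_block k) x"
  \<comment> \<open>Reversing the columns with \<open>R\<close> makes the pencil lower triangular.\<close>
  define R :: "complex mat" where "R = mat k k (\<lambda>(i, j). if i + j + 1 = k then 1 else 0)"
  have M: "M \<in> carrier_mat k k" unfolding M_def Gamma_block_def by auto
  have R: "R \<in> carrier_mat k k" unfolding R_def by simp
  have MR: "M * R = mat k k (\<lambda>(i, j). M $$ (i, k - 1 - j))"
  proof (rule eq_matI)
    fix i j assume "i < dim_row (mat k k (\<lambda>(i, j). M $$ (i, k - 1 - j)))"
      "j < dim_col (mat k k (\<lambda>(i, j). M $$ (i, k - 1 - j)))"
    hence ij: "i < k" "j < k" by auto
    have "(M * R) $$ (i, j) = (\<Sum>l=0..<k. M $$ (i, l) * R $$ (l, j))"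
      using ij M R by (auto simp: scalar_prod_def)
    also have "\<dots> = (\<Sum>l=0..<k. if l = k - 1 - j then M $$ (i, l) else 0)"
      by (rule sum.cong) (use ij in \<open>auto simp: R_def\<close>)
    finally show "(M * R) $$ (i, j) = mat k k (\<lambda>(i, j). M $$ (i, k - 1 - j)) $$ (i, j)"
      using ij by simp
  qed (use M R in auto)
  \<comment> \<open>On the antidiagonal, \<open>Gamma_block k\<close> and its transpose differ by
    the constant sign \<open>(- 1) ^ (k - 1)\<close>. Hence all diagonal entries of
    \<open>M * R\<close> are \<open>?d\<close> up to sign and vanish for the same
    \<open>x\<close>.\<close>
  let ?d = "x * \<sigma> \<alpha> - \<alpha> * (- 1) ^ (k - 1)"
  have diag: "M $$ (i, k - 1 - i) = (- 1) ^ i * ?d" if "i < k" for i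
  proof -
    obtain j where "k = Suc (i + j)" using less_imp_Suc_add[OF \<open>i < k\<close>] by blast
    thus ?thesis
      unfolding M_def Gamma_block_def by (simp add: power_add algebra_simps)
  qed
  have "det (M * R) = prod_list (diag_mat (M * R))"
    unfolding MR by (rule det_lower_triangular[where n = k])
      (auto simp: M_def Gamma_block_def)
  also have "\<dots> = (\<Prod>i=0..<k. M $$ (i, k - 1 - i))"
    unfolding MR by (simp add: prod_list_diag_prod)
  also have "\<dots> = (\<Prod>i=0..<k. (- 1) ^ i * ?d)"
    by (rule prod.cong) (use diag in auto)
  finally have "det (M * R) = (\<Prod>i=0..<k. (- 1) ^ i * ?d)" .
  moreover have "det (M * R) = 0"
    using x M R unfolding roots_def M_def by (simp add: det_mult)
  ultimately have "?d = 0" by simp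
  thus "x \<in> {(- 1) ^ (k - 1) * (\<alpha> / \<sigma> \<alpha>)}" using a by (simp add: field_simps)
qed

lemma roots_scalar_block: "\<alpha> \<noteq> 0 \<Longrightarrow> roots (scalar_block \<alpha>) = {\<alpha> / \<sigma> \<alpha>}"
  unfolding roots_def
  by (auto simp: scalar_block_def det_single pencil_def divide_simps)

end

section \<open>Counting the roots of canonical forms\<close>

lemma square_blocks [simp]:
  "square_mat (jordan_block k a)" "square_mat (H_block k a)" "square_mat (a \<cdot>\<^sub>m Gamma_block k)"
  "square_mat (scalar_block a)"
  by (auto simp: H_block_def Gamma_block_def scalar_block_def)

lemma dim_blocks [simp]:
  "dim_row (H_block k a) = 2 * k" "dim_row (Gamma_block k) = k" "dim_row (scalar_block a) = 1"
  "dim_col (H_block k a) = 2 * k" "dim_col (Gamma_block k) = k" "dim_col (scalar_block a) = 1"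
  by (auto simp: H_block_def Gamma_block_def scalar_block_def)

lemma det_jordan_block_0: "k \<ge> 1 \<Longrightarrow> det (jordan_block k (0 :: complex)) = 0"
  by (subst det_upper_triangular[where n = k])
    (auto simp: prod_list_diag_prod jordan_block_def upper_triangular_def)

lemma det_H_block_1: "\<mu> \<noteq> 0 \<Longrightarrow> det (H_block 1 \<mu>) \<noteq> 0"
  unfolding H_block_def
  by (subst det_four_block_mat[where n = 1]) (auto simp: det_single[unfolded One_nat_def] minus_carrier_mat jordan_block_def)

lemma map2_replicate: "length xs = k \<Longrightarrow> map2 f (replicate k a) xs = map (f a) xs"
  by (induction xs arbitrary: k) auto

lemma length_le_sum_list: "\<forall>x\<in>set xs. x \<ge> (1 :: nat) \<Longrightarrow> length xs \<le> sum_list xs"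
  by (induction xs) auto

lemma sum_list_eq_length: "\<forall>x\<in>set xs. x \<ge> (1 :: nat) \<Longrightarrow> sum_list xs = length xs \<Longrightarrow> \<forall>x\<in>set xs. x = 1"
proof (induction xs)
  case (Cons x xs)
  thus ?case using length_le_sum_list[of xs] by auto
qed simp

lemma star_cfc_mat_ones:
  assumes "length \<alpha>s = m" "length \<mu>s = q"
  shows "star_cfc_mat [] (replicate m 1) \<alpha>s (replicate q 1) \<mu>s =
    diag_block_mat (map scalar_block \<alpha>s @ map (H_block 1) \<mu>s)"
proof -
  have "map2 (\<lambda>l \<alpha>. \<alpha> \<cdot>\<^sub>m Gamma_block l) (replicate m 1) \<alpha>s = map scalar_block \<alpha>s"
    unfolding map2_replicate[OF assms(1)]
    by (auto simp: Gamma_block_def scalar_block_def)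
  thus ?thesis unfolding star_cfc_mat_def map2_replicate[OF assms(2)] by simp
qed

lemma dim_star_cfc_mat:
  assumes "length \<alpha>s = length ls" "length \<mu>s = length ms"
  shows "dim_row (star_cfc_mat ks ls \<alpha>s ms \<mu>s) = sum_list ks + sum_list ls + 2 * sum_list ms"
proof -
  have "sum_list (map dim_row (map2 (\<lambda>l \<alpha>. \<alpha> \<cdot>\<^sub>m Gamma_block l) ls \<alpha>s)) = sum_list ls"
    using assms(1)[symmetric] by (induction ls \<alpha>s rule: list_induct2) auto
  moreover have "sum_list (map dim_row (map2 H_block ms \<mu>s)) = 2 * sum_list ms"
    using assms(2)[symmetric] by (induction ms \<mu>s rule: list_induct2) auto
  moreover have "map dim_row (map (\<lambda>k. jordan_block k 0) ks) = ks" by (induction ks) auto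
  ultimately show ?thesis unfolding star_cfc_mat_def dim_diag_block_mat by (simp add: o_def)
qed

context congruence_type begin

text \<open>A block \<open>\<Gamma>\<^sub>k\<close> contributes at most one root and \<open>H\<^sub>2\<^sub>k\<close> at most two, so having as many roots as
  rows forces all blocks to be as small as possible and all their roots to be different.\<close>

lemma generic_star_cfc_mat:
  assumes sizes: "\<forall>k\<in>set (ks @ ls @ ms). k \<ge> 1"
    and len: "length \<alpha>s = length ls" "length \<mu>s = length ms"
    and nz: "\<forall>\<alpha>\<in>set \<alpha>s. \<alpha> \<noteq> 0" "\<forall>\<mu>\<in>set \<mu>s. \<mu> \<noteq> 0"
    and gen: "generic n m (star_cfc_mat ks ls \<alpha>s ms \<mu>s)"
  shows "ks = []" "\<forall>l\<in>set ls. l = 1" "\<forall>k\<in>set ms. k = 1"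
    "distinct (map (\<lambda>\<alpha>. \<alpha> / \<sigma> \<alpha>) \<alpha>s)" "distinct \<mu>s" "\<forall>\<mu>\<in>set \<mu>s. \<tau> \<mu> \<noteq> \<mu>"
    "length ls = m" "length ls + 2 * length ms = n"
proof -
  let ?J = "map (\<lambda>k. jordan_block k 0) ks :: complex mat list"
  let ?G = "map2 (\<lambda>l \<alpha>. \<alpha> \<cdot>\<^sub>m Gamma_block l) ls \<alpha>s" and ?H = "map2 H_block ms \<mu>s"
  let ?C = "star_cfc_mat ks ls \<alpha>s ms \<mu>s"
  have C: "?C \<in> carrier_mat n n" "det ?C \<noteq> 0" and card: "card (roots ?C) = n"
      "card {x \<in> roots ?C. \<tau> x = x} = m"
    using gen unfolding generic_def by auto
  have sq: "\<forall>D\<in>set (?J @ ?G @ ?H). square_mat D" by auto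
  show "ks = []"
  proof (rule ccontr)
    assume "ks \<noteq> []"
    then obtain k where "k \<in> set ks" by (cases ks) auto
    hence "jordan_block k 0 \<in> set (?J @ ?G @ ?H)" "det (jordan_block k (0 :: complex)) = 0"
      using sizes det_jordan_block_0 by auto
    thus False using C(2) det_diag_block_mat_nonzero[OF sq] unfolding star_cfc_mat_def by blast
  qed
  have n: "n = sum_list ls + 2 * sum_list ms"
    using dim_star_cfc_mat[OF len, of ks] C(1) \<open>ks = []\<close> by simp
  let ?A = "map2 (\<lambda>l \<alpha>. (- 1) ^ (l - 1) * (\<alpha> / \<sigma> \<alpha>)) ls \<alpha>s"
  have roots: "roots ?C = (\<Union>D\<in>set ?G. roots D) \<union> (\<Union>D\<in>set ?H. roots D)"
    using roots_diag_block_mat[OF sq] \<open>ks = []\<close> unfolding star_cfc_mat_def by (simp add: image_Un)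
  have rootsG: "(\<Union>D\<in>set ?G. roots D) \<subseteq> set ?A"
  proof
    fix x assume "x \<in> (\<Union>D\<in>set ?G. roots D)"
    then obtain l \<alpha> where la: "(l, \<alpha>) \<in> set (zip ls \<alpha>s)" "x \<in> roots (\<alpha> \<cdot>\<^sub>m Gamma_block l)"
      by auto
    hence "\<alpha> \<noteq> 0" using nz(1) set_zip_rightD by metis
    hence "x = (- 1) ^ (l - 1) * (\<alpha> / \<sigma> \<alpha>)" using roots_Gamma_block la(2) by blast
    thus "x \<in> set ?A" using la(1) by force
  qed
  have rootsH: "(\<Union>D\<in>set ?H. roots D) = set \<mu>s \<union> \<tau> ` set \<mu>s"
  proof -
    have "roots (H_block k \<mu>) = {\<mu>, \<tau> \<mu>}" if "(k, \<mu>) \<in> set (zip ms \<mu>s)" for k \<mu>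
      using that nz(2) sizes by (intro roots_H_block) (auto dest: set_zip_leftD set_zip_rightD)
    hence "(\<Union>D\<in>set ?H. roots D) = (\<Union>(k, \<mu>)\<in>set (zip ms \<mu>s). {\<mu>, \<tau> \<mu>})"
      by force
    also have "\<dots> = (\<Union>\<mu>\<in>snd ` set (zip ms \<mu>s). {\<mu>, \<tau> \<mu>})" by auto
    also have "snd ` set (zip ms \<mu>s) = set \<mu>s"
      using len(2) by (metis list.set_map map_snd_zip)
    finally show ?thesis by auto
  qed
  \<comment> \<open>These bounds form a closed chain: \<open>n\<close> is at most the number of
    candidate roots, this is at most \<open>length ls + 2 * length ms\<close>, and this is at most
    \<open>sum_list ls + 2 * sum_list ms = n\<close>. So each of them is an equality.\<close>
  have c1: "card (set ?A) \<le> length ls" using card_length[of ?A] len by simp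
  have c2: "card (set \<mu>s) \<le> length ms" using card_length[of \<mu>s] len by simp
  have c3: "card (\<tau> ` set \<mu>s) \<le> card (set \<mu>s)" by (rule card_image_le) simp
  have c4: "card (set \<mu>s \<union> \<tau> ` set \<mu>s) \<le> card (set \<mu>s) + card (\<tau> ` set \<mu>s)"
    by (rule card_Un_le)
  have c5: "n \<le> card (set ?A \<union> (set \<mu>s \<union> \<tau> ` set \<mu>s))"
    using rootsG rootsH unfolding card(1)[symmetric] roots by (intro card_mono) auto
  have c6: "card (set ?A \<union> (set \<mu>s \<union> \<tau> ` set \<mu>s)) \<le> card (set ?A) + card (set \<mu>s \<union> \<tau> ` set \<mu>s)"
    by (rule card_Un_le)
  have s: "length ls \<le> sum_list ls" "length ms \<le> sum_list ms"
    using sizes length_le_sum_list by auto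
  have "sum_list ls = length ls" "sum_list ms = length ms"
    using n s c1 c2 c3 c4 c5 c6 by linarith+
  thus ones: "\<forall>l\<in>set ls. l = 1" "\<forall>k\<in>set ms. k = 1"
    using sum_list_eq_length sizes by auto
  show len_n: "length ls + 2 * length ms = n"
    using n \<open>sum_list ls = length ls\<close> \<open>sum_list ms = length ms\<close> by simp
  have A: "?A = map (\<lambda>\<alpha>. \<alpha> / \<sigma> \<alpha>) \<alpha>s"
  proof -
    have "ls = replicate (length ls) 1" using ones(1) by (intro replicate_eqI) auto
    thus ?thesis using map2_replicate[OF len(1), of "\<lambda>l \<alpha>. (- 1) ^ (l - 1) * (\<alpha> / \<sigma> \<alpha>)" 1] by simp
  qed
  \<comment> \<open>Equality in the same chain: the first two equations give distinctness, the third
    disjointness of the parameters from their images under \<tau>.\<close>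
  have e: "card (set ?A) = length ls" "card (set \<mu>s) = length ms"
      "card (set \<mu>s \<union> \<tau> ` set \<mu>s) = card (set \<mu>s) + card (\<tau> ` set \<mu>s)"
    using len_n c1 c2 c3 c4 c5 c6 by linarith+
  show "distinct (map (\<lambda>\<alpha>. \<alpha> / \<sigma> \<alpha>) \<alpha>s)"
    using e(1) len(1) unfolding A by (intro card_distinct) simp
  show "distinct \<mu>s" using e(2) len(2) by (intro card_distinct) simp
  have disj: "set \<mu>s \<inter> \<tau> ` set \<mu>s = {}"
    using e(3) card_Un_Int[of "set \<mu>s" "\<tau> ` set \<mu>s"] by simp
  thus nonfix: "\<forall>\<mu>\<in>set \<mu>s. \<tau> \<mu> \<noteq> \<mu>" by (metis IntI emptyE imageI)
  \<comment> \<open>So far the roots were only known to lie in the candidate set. Both have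
    \<open>n\<close> elements, so they coincide and the fixed roots can be counted.\<close>
  have "roots ?C = set ?A \<union> (set \<mu>s \<union> \<tau> ` set \<mu>s)"
    using rootsG rootsH card(1) len_n e c3 c4 c6 unfolding roots
    by (intro card_seteq) auto
  moreover have "\<tau> x = x" if "x \<in> set ?A" for x
    using that nz(1) unfolding A \<tau>_def by auto
  moreover have "\<tau> x \<noteq> x" if "x \<in> set \<mu>s \<union> \<tau> ` set \<mu>s" for x
    using that nonfix by auto
  ultimately have "{x \<in> roots ?C. \<tau> x = x} = set ?A" by blast
  thus "length ls = m" using card(2) e(1) by simp
qed

lemma U_tau: "U z \<Longrightarrow> \<not> U (\<tau> z)"
  using U_paired[of z] U_nonzero U_not_fixed unfolding \<tau>_def by blast

lemma tau_U: "U z \<Longrightarrow> \<tau> z \<noteq> z"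
  using U_tau by metis

text \<open>Only the set of blocks enters, so any order of the summands is covered, both scalars
  first as in the canonical form and scalars last as in the theorem. The total size is a separate
  assumption because a set forgets repetitions.\<close>

lemma generic_blocks:
  assumes Ds: "set Ds = scalar_block ` set \<alpha>s \<union> H_block 1 ` set \<mu>s"
    and dim: "sum_list (map dim_row Ds) = length \<alpha>s + 2 * length \<mu>s"
    and nz: "\<forall>\<alpha>\<in>set \<alpha>s. \<alpha> \<noteq> 0" and U: "\<forall>\<mu>\<in>set \<mu>s. U \<mu>"
    and dist: "distinct (map (\<lambda>\<alpha>. \<alpha> / \<sigma> \<alpha>) \<alpha>s)" "distinct \<mu>s"
  shows "generic (length \<alpha>s + 2 * length \<mu>s) (length \<alpha>s) (diag_block_mat Ds)"
proof -
  let ?A = "map (\<lambda>\<alpha>. \<alpha> / \<sigma> \<alpha>) \<alpha>s" and ?C = "diag_block_mat Ds"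
  have sq: "\<forall>D\<in>set Ds. square_mat D" unfolding Ds by auto
  have C: "?C \<in> carrier_mat (length \<alpha>s + 2 * length \<mu>s) (length \<alpha>s + 2 * length \<mu>s)"
    using diag_block_mat_square[OF sq] dim unfolding carrier_mat_def
    by (simp add: dim_diag_block_mat)
  have "det D \<noteq> 0" if "D \<in> set Ds" for D
    using that nz U U_nonzero det_H_block_1 unfolding Ds by (auto simp: scalar_block_def det_single)
  hence d: "det ?C \<noteq> 0" using det_diag_block_mat_nonzero[OF sq] by blast
  have roots: "roots ?C = set ?A \<union> (set \<mu>s \<union> \<tau> ` set \<mu>s)"
    unfolding roots_diag_block_mat[OF sq] Ds using nz U U_nonzero
    by (auto simp: roots_scalar_block roots_H_block)
  have fixA: "\<tau> x = x" if "x \<in> set ?A" for x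
    using that nz unfolding \<tau>_def by auto
  have fixM: "\<tau> x \<noteq> x" if "x \<in> set \<mu>s \<union> \<tau> ` set \<mu>s" for x
    using that tau_U U by (metis UnE imageE tau_tau)
  have "{x \<in> roots ?C. \<tau> x = x} = set ?A" unfolding roots using fixA fixM by blast
  moreover have "set ?A \<inter> (set \<mu>s \<union> \<tau> ` set \<mu>s) = {}" using fixA fixM by blast
  moreover have "set \<mu>s \<inter> \<tau> ` set \<mu>s = {}" using U U_tau by blast
  moreover have "card (\<tau> ` set \<mu>s) = card (set \<mu>s)" by (rule card_image) (auto intro: inj_onI)
  ultimately show ?thesis
    using C d distinct_card[OF dist(1)] distinct_card[OF dist(2)] unfolding generic_def roots
    by (simp add: card_Un_disjoint)
qed

lemma generic_canonical:
  assumes "length \<alpha>s = m" "m + 2 * length \<mu>s = n"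
    and "\<forall>\<alpha>\<in>set \<alpha>s. \<alpha> \<noteq> 0" "\<forall>\<mu>\<in>set \<mu>s. U \<mu>"
    and "distinct (map (\<lambda>\<alpha>. \<alpha> / \<sigma> \<alpha>) \<alpha>s)" "distinct \<mu>s"
  shows "generic n m (diag_block_mat (map scalar_block \<alpha>s @ map (H_block 1) \<mu>s))"
proof -
  have "generic (length \<alpha>s + 2 * length \<mu>s) (length \<alpha>s)
    (diag_block_mat (map scalar_block \<alpha>s @ map (H_block 1) \<mu>s))"
    by (rule generic_blocks[OF _ _ assms(3-6)]) (auto simp: o_def sum_list_triv)
  with assms(1,2) show ?thesis by simp
qed

end

subsection \<open>Eigenbases and the entries of canonical forms\<close>

text \<open>Lagrange interpolation in the role of the Vandermonde determinant: the relations extend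
  from powers to all polynomials, in particular to the one that vanishes at every \<open>L j\<close>
  except \<open>L i\<close>.\<close>

lemma power_sums_eq_0_imp_eq_0:
  fixes L :: "nat \<Rightarrow> complex"
  assumes inj: "inj_on L {..<n}"
    and pow: "\<And>k. (\<Sum>j<n. a j * L j ^ k) = 0" and i: "i < n"
  shows "a i = 0"
proof -
  have poly: "(\<Sum>j<n. a j * poly q (L j)) = 0" for q
  proof -
    have "(\<Sum>j<n. a j * poly q (L j)) = (\<Sum>j<n. \<Sum>k\<le>degree q. coeff q k * (a j * L j ^ k))"
      by (simp add: poly_altdef sum_distrib_left mult_ac)
    also have "\<dots> = (\<Sum>k\<le>degree q. coeff q k * (\<Sum>j<n. a j * L j ^ k))"
      by (subst sum.swap) (simp add: sum_distrib_left)
    finally show ?thesis using pow by simp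
  qed
  define q where "q = (\<Prod>j\<in>{..<n} - {i}. [:- L j, 1:])"
  have q: "poly q x = (\<Prod>j\<in>{..<n} - {i}. x - L j)" for x
    unfolding q_def poly_prod by simp
  have "poly q (L j) = 0" if "j < n" "j \<noteq> i" for j
    unfolding q using that by (intro prod_zero) auto
  hence "(\<Sum>j<n. a j * poly q (L j)) = (\<Sum>j<n. if j = i then a i * poly q (L i) else 0)"
    by (intro sum.cong) auto
  hence "a i * poly q (L i) = 0" using poly i by simp
  moreover have "poly q (L i) \<noteq> 0"
    unfolding q using inj i by (auto simp: inj_on_def)
  ultimately show ?thesis by simp
qed

text \<open>The column of the nonzero entry in row \<open>i\<close> of \<open>m\<close> scalar blocks followed by blocks \<open>H\<^sub>2\<close>.\<close>

definition partner :: "nat \<Rightarrow> nat \<Rightarrow> nat" where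
  "partner m i = (if i < m then i else if even (i - m) then i + 1 else i - 1)"

lemma diag_block_mat_H_blocks:
  "diag_block_mat (map (H_block 1) \<mu>s) =
    mat (2 * length \<mu>s) (2 * length \<mu>s)
      (\<lambda>(i, j). if j = partner 0 i then if even i then 1 else \<mu>s ! (i div 2) else 0)"
proof (induction \<mu>s)
  case (Cons \<mu> \<mu>s)
  have H: "H_block 1 \<mu> $$ (i, j) = (if j = partner 0 i then if even i then 1 else \<mu> else 0)"
    if "i < 2" "j < 2" for i j
    using that unfolding H_block_def less_2_cases_iff by (auto simp: partner_def jordan_block_def)
  have sq: "square_mat (H_block 1 \<mu>)" "\<forall>D\<in>set (map (H_block 1) \<mu>s). square_mat D" by auto
  have step: "(\<mu> # \<mu>s) ! (i div 2) = \<mu>s ! ((i - 2) div 2)" "partner 0 i = partner 0 (i - 2) + 2"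
      "even (i - 2) = even i" if "i \<ge> 2" for i
  proof -
    obtain i' where i: "i = i' + 2" using \<open>i \<ge> 2\<close> by (metis add.commute le_Suc_ex)
    show "(\<mu> # \<mu>s) ! (i div 2) = \<mu>s ! ((i - 2) div 2)" "even (i - 2) = even i" unfolding i by simp_all
    show "partner 0 i = partner 0 (i - 2) + 2" unfolding i partner_def by (auto elim: oddE)
  qed
  have low: "partner 0 i < 2" if "i < 2" for i
    using that unfolding less_2_cases_iff by (auto simp: partner_def)
  show ?case
  proof (rule eq_matI, goal_cases)
    case (1 i j)
    hence ij: "i < 2 + 2 * length \<mu>s" "j < 2 + 2 * length \<mu>s" by auto
    have E: "diag_block_mat (map (H_block 1) (\<mu> # \<mu>s)) $$ (i, j) =
      (if i < 2 then if j < 2 then H_block 1 \<mu> $$ (i, j) else 0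
       else if j < 2 then 0
       else if j - 2 = partner 0 (i - 2) then if even (i - 2) then 1 else \<mu>s ! ((i - 2) div 2) else 0)"
      using ij unfolding list.map square_diag_block_mat_Cons[OF sq] Cons.IH by auto
    show ?case
    proof (cases "i < 2")
      case True
      thus ?thesis unfolding E using 1 low[OF True] H[OF True] by (auto simp: less_2_cases_iff)
    next
      case False
      thus ?thesis unfolding E using 1 step[of i] by auto
    qed
  qed (auto simp: dim_diag_block_mat o_def sum_list_triv)
qed (auto simp: partner_def)

text \<open>The entrywise form allows a direct comparison with the matrix of \<open>B\<close> in a
  rescaled eigenbasis.\<close>

lemma diag_block_mat_canonical:
  "diag_block_mat (map scalar_block \<alpha>s @ map (H_block 1) \<mu>s) =
    mat (length \<alpha>s + 2 * length \<mu>s) (length \<alpha>s + 2 * length \<mu>s)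
      (\<lambda>(i, j). if j = partner (length \<alpha>s) i
        then if i < length \<alpha>s then \<alpha>s ! i
          else if even (i - length \<alpha>s) then 1 else \<mu>s ! ((i - length \<alpha>s) div 2)
        else 0)"
proof (induction \<alpha>s)
  case Nil
  show ?case unfolding list.map append_Nil diag_block_mat_H_blocks by (rule eq_matI) auto
next
  case (Cons \<alpha> \<alpha>s)
  let ?Ds = "map scalar_block \<alpha>s @ map (H_block 1) \<mu>s"
  have sq: "square_mat (scalar_block \<alpha>)" "\<forall>D\<in>set ?Ds. square_mat D" by auto
  have step: "partner (length (\<alpha> # \<alpha>s)) i = partner (length \<alpha>s) (i - 1) + 1" if "i \<noteq> 0" for i
    using that by (cases i) (auto simp: partner_def elim: oddE)
  show ?case
  proof (rule eq_matI, goal_cases)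
    case (1 i j)
    thus ?case
      using step[of i] unfolding list.map append_Cons square_diag_block_mat_Cons[OF sq] Cons.IH
      by (cases i; cases j) (auto simp: partner_def[of _ 0] scalar_block_def)
  qed (auto simp: dim_diag_block_mat o_def sum_list_triv)
qed

context congruence_type begin

text \<open>Eigenvectors for different roots are linearly independent, so taken as columns they form
  an invertible \<open>V\<close>.\<close>

lemma eigenvector_matrix:
  assumes B: "B \<in> carrier_mat n n" "det B \<noteq> 0"
    and L: "\<And>i. i < n \<Longrightarrow> L i \<in> roots B" and inj: "inj_on L {..<n}"
  obtains V where "V \<in> carrier_mat n n" "det V \<noteq> 0" "B * V = sadj B * V * mat_diag n L"
proof -
  have "\<exists>v. v \<in> carrier_vec n \<and> v \<noteq> 0\<^sub>v n \<and> pencil B (L i) *\<^sub>v v = 0\<^sub>v n" if "i < n" for i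
    using L[OF that] det_0_iff_vec_prod_zero[OF pencil_carrier[OF B(1)]] unfolding roots_def by auto
  then obtain v where v: "\<And>i. i < n \<Longrightarrow> v i \<in> carrier_vec n" "\<And>i. i < n \<Longrightarrow> v i \<noteq> 0\<^sub>v n"
      "\<And>i. i < n \<Longrightarrow> pencil B (L i) *\<^sub>v v i = 0\<^sub>v n"
    by metis
  define V where "V = mat n n (\<lambda>(r, c). v c $ r)"
  let ?D = "mat_diag n L"
  have V: "V \<in> carrier_mat n n" unfolding V_def by simp
  have B': "sadj B \<in> carrier_mat n n" using B by simp
  have D: "?D \<in> carrier_mat n n" by simp
  have BV: "B * V = sadj B * V * ?D"
  proof (rule eq_matI)
    fix r c assume "r < dim_row (sadj B * V * ?D)" "c < dim_col (sadj B * V * ?D)"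
    hence rc: "r < n" "c < n" using B carrier_matD[OF mat_diag_dim[of n L]] by auto
    have "(pencil B (L c) *\<^sub>v v c) $ r = L c * (\<Sum>k=0..<n. \<sigma> (B $$ (k, r)) * v c $ k) - (\<Sum>k=0..<n. B $$ (r, k) * v c $ k)"
      using rc B v(1)[OF rc(2)]
      by (simp add: scalar_prod_def sum_distrib_left sum_subtractf algebra_simps)
    hence "L c * (\<Sum>k=0..<n. \<sigma> (B $$ (k, r)) * v c $ k) = (\<Sum>k=0..<n. B $$ (r, k) * v c $ k)"
      using v(3)[OF rc(2)] rc by simp
    moreover have "(B * V) $$ (r, c) = (\<Sum>k=0..<n. B $$ (r, k) * v c $ k)"
      using rc B by (simp add: V_def scalar_prod_def)
    moreover have "(sadj B * V * ?D) $$ (r, c) = (\<Sum>k=0..<n. \<sigma> (B $$ (k, r)) * v c $ k) * L c"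
      unfolding mat_diag_mult_right[OF mult_carrier_mat[OF B' V]]
      using rc B by (simp add: V_def scalar_prod_def)
    ultimately show "(B * V) $$ (r, c) = (sadj B * V * ?D) $$ (r, c)"
      by (simp add: mult.commute)
  qed (use B carrier_matD[OF mat_diag_dim[of n L]] V in auto)
  have "det V \<noteq> 0"
  proof
    assume "det V = 0"
    then obtain c where c: "c \<in> carrier_vec n" "c \<noteq> 0\<^sub>v n" "V *\<^sub>v c = 0\<^sub>v n"
      using det_0_iff_vec_prod_zero[OF V] by auto
    obtain C where C: "C \<in> carrier_mat n n" "C * sadj B = 1\<^sub>m n"
      using inverse_mat_exists[OF B'] B(2) det_sadj[OF B(1)] by auto
    \<comment> \<open>Each application of \<open>B\<close>, followed by cancelling the invertible
      \<open>sadj B\<close>, multiplies the \<open>j\<close>-th coefficient of the relation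
      \<open>V c = 0\<close> by \<open>L j\<close>.\<close>
    have pow: "V *\<^sub>v vec n (\<lambda>j. L j ^ k * c $ j) = 0\<^sub>v n" for k
    proof (induction k)
      case 0
      have "vec n (\<lambda>j. L j ^ 0 * c $ j) = c" using c(1) by auto
      thus ?case using c(3) by simp
    next
      case (Suc k)
      let ?w = "vec n (\<lambda>j. L j ^ k * c $ j)" and ?w' = "vec n (\<lambda>j. L j ^ Suc k * c $ j)"
      have w: "?w \<in> carrier_vec n" "?w' \<in> carrier_vec n" by auto
      have "?D *\<^sub>v ?w = ?w'"
        by (rule eq_vecI) (auto simp: mat_diag_def scalar_prod_def if_distrib[where f = "\<lambda>x. x * _"] sum.delta' cong: if_cong)
      hence "sadj B *\<^sub>v (V *\<^sub>v ?w') = (sadj B * V * ?D) *\<^sub>v ?w"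
        using assoc_mult_mat_vec[OF mult_carrier_mat[OF B' V] D w(1)] assoc_mult_mat_vec[OF B' V w(2)] by simp
      also have "\<dots> = B *\<^sub>v (V *\<^sub>v ?w)"
        unfolding BV[symmetric] by (rule assoc_mult_mat_vec[OF B(1) V w(1)])
      also have "\<dots> = 0\<^sub>v n" unfolding Suc using B(1) by auto
      finally have "C *\<^sub>v (sadj B *\<^sub>v (V *\<^sub>v ?w')) = 0\<^sub>v n" using C(1) by auto
      thus ?case
        using assoc_mult_mat_vec[OF C(1) B' mult_mat_vec_carrier[OF V w(2)]] C(2) V by simp
    qed
    \<comment> \<open>Row \<open>r\<close> of these relations is a family of vanishing power sums
      with coefficients \<open>v j $ r * c $ j\<close>.\<close>
    have "v i $ r * c $ i = 0" if "i < n" "r < n" for i r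
    proof (rule power_sums_eq_0_imp_eq_0[OF inj])
      fix k
      have "(V *\<^sub>v vec n (\<lambda>j. L j ^ k * c $ j)) $ r = 0" unfolding pow using that by simp
      thus "(\<Sum>j<n. v j $ r * c $ j * L j ^ k) = 0"
        using that by (simp add: V_def scalar_prod_def mult_ac atLeast0LessThan)
    qed fact
    moreover obtain i where i: "i < n" "c $ i \<noteq> 0"
      using c(1,2) by (metis carrier_vecD eq_vecI index_zero_vec)
    ultimately have "v i = 0\<^sub>v n" using v(1)[OF i(1)] by (intro eq_vecI) auto
    thus False using v(2)[OF i(1)] by simp
  qed
  with V BV that show thesis by blast
qed

text \<open>\<open>W\<close> is the matrix of the form in the eigenbasis. Multiplying the
  eigenvector equation by \<open>sadj V\<close> from the left gives
  \<open>W = sadj W * mat_diag n L\<close>.\<close>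

lemma eigenvector_form:
  assumes B: "B \<in> carrier_mat n n" and V: "V \<in> carrier_mat n n"
    and BV: "B * V = sadj B * V * mat_diag n L"
    and ij: "i < n" "j < n"
  defines "W \<equiv> sadj V * B * V"
  shows "W $$ (i, j) = \<sigma> (W $$ (j, i)) * L j"
proof -
  have B': "sadj B \<in> carrier_mat n n" and V': "sadj V \<in> carrier_mat n n" using B V by auto
  have W: "W \<in> carrier_mat n n" unfolding W_def by (rule mult_carrier_mat[OF mult_carrier_mat[OF V' B] V])
  have "sadj W = sadj V * (sadj B * V)"
    unfolding W_def sadj_mult[OF mult_carrier_mat[OF V' B] V] sadj_mult[OF V' B] by simp
  moreover have "W = sadj V * (sadj B * V * mat_diag n L)"
    unfolding W_def assoc_mult_mat[OF V' B V] BV ..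
  ultimately have "W = sadj W * mat_diag n L"
    using assoc_mult_mat[OF V' mult_carrier_mat[OF B' V] mat_diag_dim] by simp
  also have "\<dots> = mat n n (\<lambda>(i, j). sadj W $$ (i, j) * L j)"
    by (rule mat_diag_mult_right) (use W in simp)
  finally have "W $$ (i, j) = mat n n (\<lambda>(i, j). sadj W $$ (i, j) * L j) $$ (i, j)" by (rule arg_cong)
  thus ?thesis using ij W by simp
qed

end

section \<open>Normal forms of generic matrices\<close>

context congruence_type begin

lemma generic_normal_form:
  assumes gen: "generic n m B"
  obtains \<alpha>s \<mu>s P where
    "length \<alpha>s = m" "m + 2 * length \<mu>s = n" "\<forall>\<alpha>\<in>set \<alpha>s. N \<alpha>" "\<forall>\<mu>\<in>set \<mu>s. U \<mu>"
    "distinct (map (\<lambda>\<alpha>. \<alpha> / \<sigma> \<alpha>) \<alpha>s)" "distinct \<mu>s" "P \<in> carrier_mat n n" "det P \<noteq> 0"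
    "sadj P * B * P = diag_block_mat (map scalar_block \<alpha>s @ map (H_block 1) \<mu>s)"
proof -
  let ?R = "roots B"
  have B: "B \<in> carrier_mat n n" "det B \<noteq> 0" and card: "card ?R = n" "card {x \<in> ?R. \<tau> x = x} = m"
    using gen unfolding generic_def by auto
  note fin = finite_card_roots(1)[OF B]
  obtain fs where fs: "set fs = {x \<in> ?R. \<tau> x = x}" "distinct fs"
    using finite_distinct_list[of "{x \<in> ?R. \<tau> x = x}"] fin by auto
  obtain us where us: "set us = {x \<in> ?R. U x}" "distinct us"
    using finite_distinct_list[of "{x \<in> ?R. U x}"] fin by auto
  let ?q = "length us"
  have m: "length fs = m" using card(2) distinct_card[OF fs(2)] fs(1) by simp
  have "x \<in> set fs \<union> (set us \<union> \<tau> ` set us)" if x: "x \<in> ?R" for x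
  proof (cases "\<tau> x = x")
    case False
    have "x \<noteq> 0" using roots_nonzero[OF B x] .
    hence "U (\<tau> x) \<longleftrightarrow> \<not> U x" using U_paired[of x] False tau_fixed_iff unfolding \<tau>_def by blast
    thus ?thesis using x tau_roots[OF B x] tau_tau[of x] unfolding us(1) by (metis (mono_tags) UnI1 UnI2 imageI mem_Collect_eq)
  qed (use x fs in auto)
  hence R: "?R = set fs \<union> (set us \<union> \<tau> ` set us)"
    using fs(1) us(1) tau_roots[OF B] by auto
  have "\<tau> x \<noteq> x" if "x \<in> set us \<union> \<tau> ` set us" for x
    using that tau_U us(1) by auto (metis tau_tau)
  hence "set fs \<inter> (set us \<union> \<tau> ` set us) = {}" using fs(1) by blast
  moreover have "set us \<inter> \<tau> ` set us = {}" using us(1) U_tau by blast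
  moreover have "card (\<tau> ` set us) = card (set us)" by (rule card_image) (auto intro: inj_onI)
  ultimately have n: "n = m + 2 * ?q"
    using card(1) m distinct_card[OF fs(2)] distinct_card[OF us(2)] unfolding R
    by (simp add: card_Un_disjoint)
  \<comment> \<open>The fixed roots come first, then each chosen root \<open>u\<close> directly
    before \<open>\<tau> u\<close>. In this order \<tau> acts on the indices as
    \<open>partner m\<close>.\<close>
  define L where "L i = (if i < m then fs ! i else if even (i - m) then us ! ((i - m) div 2)
    else \<tau> (us ! ((i - m) div 2)))" for i
  have L_fix: "L i = fs ! i" if "i < m" for i using that unfolding L_def by simp
  have L_even: "L (m + 2 * k) = us ! k" and L_odd: "L (m + 2 * k + 1) = \<tau> (us ! k)" for k
    unfolding L_def by simp_all
  have idx: "i < m \<or> (\<exists>k<?q. i = m + 2 * k) \<or> (\<exists>k<?q. i = m + 2 * k + 1)" if "i < n" for i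
  proof (cases "i < m")
    case False
    then obtain j where "i = m + j" using le_Suc_ex not_less by blast
    thus ?thesis using that n by (cases "even j") (auto elim!: evenE oddE)
  qed simp
  have partner: "partner m i = i" if "i < m" for i using that unfolding partner_def by simp
  have partner': "partner m (m + 2 * k) = m + 2 * k + 1" "partner m (m + 2 * k + 1) = m + 2 * k" for k
    unfolding partner_def by simp_all
  have p: "partner m i < n" "L (partner m i) = \<tau> (L i)" "partner m (partner m i) = i" if "i < n" for i
  proof -
    from idx[OF that] consider "i < m" | k where "k < ?q" "i = m + 2 * k" | k where "k < ?q" "i = m + 2 * k + 1"
      by blast
    hence "partner m i < n \<and> L (partner m i) = \<tau> (L i) \<and> partner m (partner m i) = i"
    proof cases
      case 1
      have "fs ! i \<in> {x \<in> ?R. \<tau> x = x}" using 1 m fs(1) nth_mem by metis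
      thus ?thesis using 1 that by (simp add: partner L_fix)
    next
      case 2
      show ?thesis unfolding 2(2) partner' L_even L_odd using 2(1) n by simp
    next
      case 3
      show ?thesis unfolding 3(2) partner' L_even L_odd using 3(1) n by simp
    qed
    thus "partner m i < n" "L (partner m i) = \<tau> (L i)" "partner m (partner m i) = i" by auto
  qed
  have L_image: "L ` {..<n} = ?R"
  proof
    show "L ` {..<n} \<subseteq> ?R"
    proof
      fix x assume "x \<in> L ` {..<n}"
      then obtain i where i: "i < n" "x = L i" by auto
      from idx[OF i(1)] consider "i < m" | k where "k < ?q" "i = m + 2 * k" | k where "k < ?q" "i = m + 2 * k + 1"
        by blast
      thus "x \<in> ?R"
      proof cases
        case 1
        thus ?thesis unfolding i(2) L_fix[OF 1] R using m by simp
      next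
        case 2
        thus ?thesis unfolding i(2) 2(2) L_even R by simp
      next
        case 3
        thus ?thesis unfolding i(2) 3(2) L_odd R by simp
      qed
    qed
    show "?R \<subseteq> L ` {..<n}"
    proof
      fix x assume "x \<in> ?R"
      then consider "x \<in> set fs" | "x \<in> set us" | "x \<in> \<tau> ` set us" unfolding R by blast
      thus "x \<in> L ` {..<n}"
      proof cases
        case 1
        then obtain i where "i < m" "x = fs ! i" using m by (metis in_set_conv_nth)
        thus ?thesis using L_fix n by (intro image_eqI[of _ _ i]) auto
      next
        case 2
        then obtain k where "k < ?q" "x = us ! k" by (metis in_set_conv_nth)
        thus ?thesis using L_even n by (intro image_eqI[of _ _ "m + 2 * k"]) auto
      next
        case 3
        then obtain k where "k < ?q" "x = \<tau> (us ! k)" by (metis imageE in_set_conv_nth)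
        thus ?thesis using L_odd n by (intro image_eqI[of _ _ "m + 2 * k + 1"]) auto
      qed
    qed
  qed
  have inj: "inj_on L {..<n}" by (rule eq_card_imp_inj_on) (simp_all add: L_image card(1))
  obtain V where V: "V \<in> carrier_mat n n" "det V \<noteq> 0" "B * V = sadj B * V * mat_diag n L"
    using eigenvector_matrix[OF B _ inj] L_image by blast
  define W where "W = sadj V * B * V"
  have W: "W \<in> carrier_mat n n"
    unfolding W_def by (rule mult_carrier_mat[OF mult_carrier_mat[OF sadj_carrier[OF V(1)] B(1)] V(1)])
  have detW: "det W \<noteq> 0" unfolding W_def using det_congruence[OF B(1) V(1)] V(2) B(2) by simp
  have form: "W $$ (i, j) = \<sigma> (W $$ (j, i)) * L j" if "i < n" "j < n" for i j
    unfolding W_def by (rule eigenvector_form[OF B(1) V(1,3) that])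
  have supp: "j = partner m i" if ij: "i < n" "j < n" and nz: "W $$ (i, j) \<noteq> 0" for i j
  proof -
    have "L i \<noteq> 0" using roots_nonzero[OF B] L_image ij(1) by blast
    \<comment> \<open>The symmetry \<open>form\<close> is applied twice, to \<open>(i, j)\<close>
      and to \<open>(j, i)\<close>.\<close>
    have "W $$ (i, j) = W $$ (i, j) * \<sigma> (L i) * L j"
      using form[OF ij] form[OF ij(2,1)] by simp
    hence "\<sigma> (L i) * L j = 1" using nz by simp
    hence "L j = \<tau> (L i)" using \<open>L i \<noteq> 0\<close> unfolding \<tau>_def by (simp add: field_simps)
    hence "L j = L (partner m i)" using p(2)[OF ij(1)] by simp
    thus ?thesis using inj_onD[OF inj] ij p(1)[OF ij(1)] by simp
  qed
  have nz: "W $$ (i, partner m i) \<noteq> 0" if i: "i < n" for i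
  proof
    assume z: "W $$ (i, partner m i) = 0"
    \<comment> \<open>As \<open>partner m\<close> is an involution, column
      \<open>partner m i\<close> can be nonzero only in row \<open>i\<close>. If that entry vanished
      too, \<open>W\<close> would be singular.\<close>
    have "W $$ (k, partner m i) = 0" if k: "k < n" for k
      using supp[OF k p(1)[OF i]] z p(3)[OF i] p(3)[OF k] by metis
    hence "W *\<^sub>v unit_vec n (partner m i) = 0\<^sub>v n"
      using W p(1)[OF i] by (intro eq_vecI) auto
    moreover have "unit_vec n (partner m i) \<noteq> (0\<^sub>v n :: complex vec)"
      using p(1)[OF i] by simp
    ultimately have "det W = 0"
      unfolding det_0_iff_vec_prod_zero[OF W] using unit_vec_carrier[of n] by (intro exI conjI)
    thus False using detW by simp
  qed
  have "\<exists>t. t \<noteq> 0 \<and> N (\<sigma> t * W $$ (i, i) * t)" if "i < m" for i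
    using N_scaling[OF nz[of i]] partner[OF that] that n by simp
  then obtain s where s: "\<And>i. i < m \<Longrightarrow> s i \<noteq> 0" "\<And>i. i < m \<Longrightarrow> N (\<sigma> (s i) * W $$ (i, i) * s i)"
    by metis
  \<comment> \<open>Fixed roots use the factor that normalises their scalar. In a pair the first
    vector is kept and the second is divided by the upper entry \<open>w\<close>, which becomes 1;
    the lower entry \<open>\<sigma> w * \<mu>\<close> is divided by \<open>\<sigma> w\<close> and
    becomes \<mu>.\<close>
  define t where "t i = (if i < m then s i else if even (i - m) then 1 else 1 / W $$ (i - 1, i))" for i
  define T where "T = mat_diag n t"
  define P where "P = V * T"
  define \<alpha>s where "\<alpha>s = map (\<lambda>i. \<sigma> (s i) * W $$ (i, i) * s i) [0..<m]"
  have T: "T \<in> carrier_mat n n" unfolding T_def by simp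
  have P: "P \<in> carrier_mat n n" unfolding P_def using V(1) T by simp
  have t: "t i = s i" if "i < m" for i using that unfolding t_def by simp
  have t': "t (m + 2 * k) = 1" "t (m + 2 * k + 1) = 1 / W $$ (m + 2 * k, m + 2 * k + 1)" for k
    unfolding t_def by simp_all
  have nzW: "W $$ (m + 2 * k, m + 2 * k + 1) \<noteq> 0" if "k < ?q" for k
    using nz[of "m + 2 * k"] that n unfolding partner' by simp
  have t_nz: "t i \<noteq> 0" if "i < n" for i
  proof -
    from idx[OF that] consider "i < m" | k where "k < ?q" "i = m + 2 * k" | k where "k < ?q" "i = m + 2 * k + 1"
      by blast
    thus ?thesis
    proof cases
      case 1
      thus ?thesis using s(1) by (simp add: t)
    next
      case 2
      thus ?thesis by (simp add: t')
    next
      case 3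
      thus ?thesis using nzW[OF 3(1)] unfolding 3(2) t' by simp
    qed
  qed
  have "det T \<noteq> 0"
    unfolding T_def using t_nz
    by (subst det_upper_triangular[where n = n])
      (auto simp: upper_triangular_def mat_diag_def prod_list_diag_prod)
  hence detP: "det P \<noteq> 0" unfolding P_def using det_mult[OF V(1) T] V(2) by simp
  have V': "sadj V \<in> carrier_mat n n" and T': "sadj T \<in> carrier_mat n n" using V T by auto
  have "sadj P * B * P = sadj T * (sadj V * (B * (V * T)))"
    unfolding P_def sadj_mult[OF V(1) T]
    using assoc_mult_mat[OF mult_carrier_mat[OF T' V'] B(1) mult_carrier_mat[OF V(1) T]]
      assoc_mult_mat[OF T' V' mult_carrier_mat[OF B(1) mult_carrier_mat[OF V(1) T]]] by simp
  also have "sadj V * (B * (V * T)) = W * T"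
    unfolding W_def using assoc_mult_mat[OF V' B(1) mult_carrier_mat[OF V(1) T]]
      assoc_mult_mat[OF mult_carrier_mat[OF V' B(1)] V(1) T] by simp
  also have "sadj T = mat_diag n (\<lambda>i. \<sigma> (t i))"
    unfolding T_def by (rule eq_matI) (auto simp: mat_diag_def)
  finally have PBP: "sadj P * B * P = mat_diag n (\<lambda>i. \<sigma> (t i)) * (W * T)" .
  have entry: "(sadj P * B * P) $$ (i, j) = \<sigma> (t i) * W $$ (i, j) * t j" if "i < n" "j < n" for i j
    unfolding PBP mat_diag_mult_left[OF mult_carrier_mat[OF W T]] 
    using that unfolding T_def mat_diag_mult_right[OF W] by simp
  have "sadj P * B * P = diag_block_mat (map scalar_block \<alpha>s @ map (H_block 1) us)"
    unfolding diag_block_mat_canonical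
  proof (rule eq_matI, goal_cases)
    case (1 i j)
    hence ij: "i < n" "j < n" unfolding n \<alpha>s_def by auto
    have "\<sigma> (t i) * W $$ (i, j) * t j = (if j = partner m i
        then if i < m then \<alpha>s ! i else if even (i - m) then 1 else us ! ((i - m) div 2) else 0)"
    proof (cases "j = partner m i")
      case False
      thus ?thesis using supp[OF ij] by auto
    next
      case True
      from idx[OF ij(1)] consider "i < m" | k where "k < ?q" "i = m + 2 * k" | k where "k < ?q" "i = m + 2 * k + 1"
        by blast
      thus ?thesis
      proof cases
        case 1
        thus ?thesis using True by (simp add: partner t \<alpha>s_def)
      next
        case 2
        have j: "j = m + 2 * k + 1" using True unfolding 2(2) partner' .
        show ?thesis unfolding j unfolding 2(2) t' partner' using nzW[OF 2(1)] by simp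
      next
        case 3
        have j: "j = m + 2 * k" using True unfolding 3(2) partner' .
        have "W $$ (m + 2 * k + 1, m + 2 * k) = \<sigma> (W $$ (m + 2 * k, m + 2 * k + 1)) * us ! k"
          using form[of "m + 2 * k + 1" "m + 2 * k"] 3(1) n unfolding L_even by simp
        thus ?thesis unfolding j unfolding 3(2) t' partner' using nzW[OF 3(1)] by simp
      qed
    qed
    thus ?case using entry[OF ij] ij unfolding n \<alpha>s_def by simp
  qed (use P B n in \<open>auto simp: \<alpha>s_def\<close>)
  \<comment> \<open>The factor \<open>\<sigma> (s i) * s i\<close> is invariant under \<sigma> and
    cancels in the quotient, so rescaling does not change the root.\<close>
  moreover have "map (\<lambda>\<alpha>. \<alpha> / \<sigma> \<alpha>) \<alpha>s = fs"
  proof (rule nth_equalityI)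
    fix i assume "i < length (map (\<lambda>\<alpha>. \<alpha> / \<sigma> \<alpha>) \<alpha>s)"
    hence i: "i < m" unfolding \<alpha>s_def by simp
    have "W $$ (i, i) = \<sigma> (W $$ (i, i)) * fs ! i" using form[of i i] i n L_fix[OF i] by simp
    moreover have "W $$ (i, i) \<noteq> 0" using nz[of i] i n partner[OF i] by simp
    ultimately show "map (\<lambda>\<alpha>. \<alpha> / \<sigma> \<alpha>) \<alpha>s ! i = fs ! i"
      using i s(1)[OF i] unfolding \<alpha>s_def by (simp add: field_simps)
  qed (simp add: \<alpha>s_def m)
  moreover have "\<forall>\<alpha>\<in>set \<alpha>s. N \<alpha>" using s(2) unfolding \<alpha>s_def by auto
  ultimately show thesis
    using that[of \<alpha>s us P] fs(2) us P detP n by (simp add: \<alpha>s_def)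
qed

text \<open>The bundles have \<open>P\<close> on the left and its adjoint on the right. With
  \<open>Q\<close> the inverse of the normalising matrix, \<open>sadj Q\<close> takes the place of
  \<open>P\<close>.\<close>

lemma generic_decomposition:
  assumes gen: "generic n m B"
  obtains \<alpha>s \<mu>s P where
    "length \<alpha>s = m" "m + 2 * length \<mu>s = n" "\<forall>\<alpha>\<in>set \<alpha>s. N \<alpha>" "\<forall>\<mu>\<in>set \<mu>s. U \<mu>"
    "distinct (map (\<lambda>\<alpha>. \<alpha> / \<sigma> \<alpha>) \<alpha>s)" "distinct \<mu>s" "P \<in> carrier_mat n n" "det P \<noteq> 0"
    "B = P * diag_block_mat (map scalar_block \<alpha>s @ map (H_block 1) \<mu>s) * sadj P"
proof -
  obtain \<alpha>s \<mu>s P where *: "length \<alpha>s = m" "m + 2 * length \<mu>s = n" "\<forall>\<alpha>\<in>set \<alpha>s. N \<alpha>" "\<forall>\<mu>\<in>set \<mu>s. U \<mu>"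
      "distinct (map (\<lambda>\<alpha>. \<alpha> / \<sigma> \<alpha>) \<alpha>s)" "distinct \<mu>s" and P: "P \<in> carrier_mat n n" "det P \<noteq> 0"
      and C: "sadj P * B * P = diag_block_mat (map scalar_block \<alpha>s @ map (H_block 1) \<mu>s)"
    using generic_normal_form[OF gen] by blast
  have B: "B \<in> carrier_mat n n" using gen unfolding generic_def by simp
  obtain Q where Q: "Q \<in> carrier_mat n n" "P * Q = 1\<^sub>m n" "det Q \<noteq> 0"
    using inverse_mat_exists[OF P] by metis
  have P': "sadj P \<in> carrier_mat n n" and Q': "sadj Q \<in> carrier_mat n n" using P Q by auto
  have QP: "sadj Q * sadj P = 1\<^sub>m n" using sadj_mult[OF P(1) Q(1)] Q(2) by simp
  have "sadj Q * (sadj P * B * P) * Q = sadj Q * ((sadj P * B * P) * Q)"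
    by (rule assoc_mult_mat[OF Q' mult_carrier_mat[OF mult_carrier_mat[OF P' B] P(1)] Q(1)])
  also have "(sadj P * B * P) * Q = sadj P * B * (P * Q)"
    by (rule assoc_mult_mat[OF mult_carrier_mat[OF P' B] P(1) Q(1)])
  also have "\<dots> = sadj P * B" unfolding Q(2) by (rule right_mult_one_mat[OF mult_carrier_mat[OF P' B]])
  also have "sadj Q * (sadj P * B) = B"
    using assoc_mult_mat[OF Q' P' B] QP B by simp
  finally have "B = sadj Q * diag_block_mat (map scalar_block \<alpha>s @ map (H_block 1) \<mu>s) * sadj (sadj Q)"
    using C by simp
  moreover have "det (sadj Q) \<noteq> 0" using Q det_sadj[OF Q(1)] by simp
  ultimately show thesis using that * Q' by blast
qed

lemma open_mat_set_generic: "open_mat_set n {B. generic n m B}"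
  unfolding open_mat_set_def using generic_open by (fastforce simp: generic_def)

end

subsection \<open>The bundles\<close>

text \<open>The angle condition describes the open upper half of the unit circle. The sign of the
  imaginary part is easier to follow under \<open>z \<mapsto> 1 / z\<close>, which swaps the two
  halves.\<close>

lemma typeIIa_param_iff: "typeIIa_param z \<longleftrightarrow> cmod z > 1 \<or> cmod z = 1 \<and> Im z > 0"
proof
  assume "typeIIa_param z"
  moreover have "cmod (exp (\<i> * complex_of_real t)) = 1" "Im (exp (\<i> * complex_of_real t)) = sin t" for t
    by (simp_all add: Im_exp)
  ultimately show "cmod z > 1 \<or> cmod z = 1 \<and> Im z > 0"
    unfolding typeIIa_param_def using sin_gt_zero by auto
next
  assume "cmod z > 1 \<or> cmod z = 1 \<and> Im z > 0"
  moreover have "\<exists>\<theta>. 0 < \<theta> \<and> \<theta> < pi \<and> z = exp (\<i> * complex_of_real \<theta>)" if z: "cmod z = 1" "Im z > 0"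
  proof (intro exI conjI)
    have sq: "(Re z)\<^sup>2 + (Im z)\<^sup>2 = 1" using z(1) by (simp add: cmod_def)
    hence "(Re z)\<^sup>2 < 1" using z(2) by (smt (verit) zero_less_power)
    hence b: "-1 < Re z" "Re z < 1" using power2_less_imp_less abs_square_less_1 by (auto simp: abs_less_iff)
    show "0 < arccos (Re z)" "arccos (Re z) < pi" using arccos_lt_bounded[OF b] by auto
    have "sqrt (1 - (Re z)\<^sup>2) = Im z" using sq z(2) by (intro real_sqrt_unique) auto
    thus "z = exp (\<i> * complex_of_real (arccos (Re z)))"
      using b sin_arccos[of "Re z"] by (simp add: complex_eq_iff Re_exp Im_exp)
  qed
  ultimately show "typeIIa_param z" unfolding typeIIa_param_def by blast
qed

text \<open>\<open>id\<close> and not \<open>\<lambda>x. x\<close>: the latter would turn the simplification rules of the locale into looping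
  identities such as \<open>cmod x = cmod x\<close>.\<close>

interpretation trans: congruence_type id typeIIa_param "\<lambda>z. z = 1"
proof
  fix z :: complex
  show "typeIIa_param (1 / id z) \<longleftrightarrow> \<not> typeIIa_param z" if z: "z \<noteq> 0" "z * id z \<noteq> 1"
  proof (cases "cmod z = 1")
    case True
    \<comment> \<open>The only real points of the unit circle are 1 and -1, and these are excluded
      because they are their own inverses.\<close>
    have "Im z \<noteq> 0"
    proof
      assume "Im z = 0"
      moreover from this have "(Re z)\<^sup>2 = 1" using True by (simp add: cmod_def abs_square_eq_1)
      ultimately have "z * z = 1" by (simp add: complex_eq_iff power2_eq_square)
      thus False using z(2) by simp
    qed
    moreover have "Im (1 / z) = - Im z"
      using True by (simp add: Im_divide cmod_def)
    ultimately show ?thesis using True unfolding typeIIa_param_iff by (auto simp: norm_divide)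
  next
    case False
    thus ?thesis using z(1) unfolding typeIIa_param_iff by (auto simp: norm_divide field_simps)
  qed
  assume z: "typeIIa_param z"
  show "z \<noteq> 0" using z unfolding typeIIa_param_iff by auto
  show "z * id z \<noteq> 1"
  proof
    assume "z * id z = 1"
    hence "z = 1 \<or> z = -1" by (simp add: square_eq_1_iff)
    thus False using z unfolding typeIIa_param_iff by auto
  qed
next
  fix c :: complex
  assume "c \<noteq> 0"
  have "csqrt c * csqrt c = c" using power2_csqrt[of c] by (simp add: power2_eq_square)
  with \<open>c \<noteq> 0\<close> show "\<exists>t. t \<noteq> 0 \<and> id t * c * t = 1"
    by (intro exI[of _ "1 / csqrt c"]) (auto simp: field_simps)
qed auto

text \<open>Here \<tau> is the reflection in the unit circle, which is exactly its set of nonzero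
  fixed points. Rescaling multiplies a scalar by \<open>(cmod t)\<^sup>2\<close>, so it can
  normalise the modulus but never the argument.\<close>

interpretation star: congruence_type cnj "\<lambda>z. cmod z > 1" "\<lambda>z. cmod z = 1"
proof
  fix z :: complex
  have one: "z * cnj z = 1 \<longleftrightarrow> cmod z = 1"
    unfolding complex_norm_square[symmetric] of_real_eq_1_iff power2_eq_1_iff
    using norm_ge_zero[of z] by linarith
  show "cmod (1 / cnj z) > 1 \<longleftrightarrow> \<not> cmod z > 1" if "z \<noteq> 0" "z * cnj z \<noteq> 1"
    using that unfolding one by (auto simp: norm_divide field_simps)
  show "z * cnj z \<noteq> 1" if "cmod z > 1" using that unfolding one by simp
next
  fix c :: complex
  assume "c \<noteq> 0"
  hence "cmod (cnj (of_real (1 / sqrt (cmod c))) * c * of_real (1 / sqrt (cmod c))) = 1"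
    by (simp add: norm_mult norm_divide field_simps)
  with \<open>c \<noteq> 0\<close> show "\<exists>t. t \<noteq> 0 \<and> cmod (cnj t * c * t) = 1"
    by (intro exI[of _ "of_real (1 / sqrt (cmod c))"]) auto
qed auto

lemma sadj_eq_transpose_mat: "trans.sadj P = transpose_mat P"
  by (rule eq_matI) (auto simp: trans.sadj_def)

lemma sadj_eq_mat_adjoint: "star.sadj P = mat_adjoint P"
  by (rule eq_matI) (auto simp: star.sadj_def mat_adjoint_def mat_of_rows_def)

text \<open>Type I blocks get the coefficient 1 and Type II-(b) blocks join the other
  \<open>H_block\<close> summands. Thus the same count of roots,
  \<open>generic_star_cfc_mat\<close>, serves both kinds of congruence.\<close>

lemma cfc_mat_eq_star_cfc_mat:
  assumes "length \<mu>s = length ms"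
  shows "cfc_mat ks ls ms \<mu>s ps =
    star_cfc_mat ks ls (replicate (length ls) 1) (ms @ ps) (\<mu>s @ map (\<lambda>p. (- 1) ^ p) ps)"
proof -
  have "map2 (\<lambda>l \<alpha>. \<alpha> \<cdot>\<^sub>m Gamma_block l) ls (replicate (length ls) 1) = map Gamma_block ls"
    by (induction ls) auto
  moreover have "map2 H_block ps (map (\<lambda>p. (- 1) ^ p) ps) = map (\<lambda>p. H_block p ((- 1) ^ p)) ps"
    by (induction ps) auto
  ultimately show ?thesis unfolding cfc_mat_def star_cfc_mat_def using assms by simp
qed

text \<open>Every canonical form of a generic matrix has blocks of least size and distinct
  parameters, and new parameters with the same pattern of equalities are again distinct. Conversely,
  \<open>n\<close> and \<open>m\<close> determine the number of blocks of each kind, so the normal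
  forms of \<open>A\<close> and \<open>B\<close> differ only in their parameters.\<close>

lemma congruence_bundle_generic:
  assumes gen: "trans.generic n m A"
  shows "congruence_bundle A = {B. trans.generic n m B}"
proof
  have A: "A \<in> carrier_mat n n" using gen unfolding trans.generic_def by simp
  show "congruence_bundle A \<subseteq> {B. trans.generic n m B}"
  proof
    fix B assume "B \<in> congruence_bundle A"
    then obtain P ks ls ms \<mu>s \<nu>s ps where B: "B = P * cfc_mat ks ls ms \<nu>s ps * transpose_mat P"
      and cfc: "is_cfc A ks ls ms \<mu>s ps" and P: "P \<in> carrier_mat n n" "invertible_mat P"
      and \<nu>s: "length \<nu>s = length ms" "\<forall>\<nu>\<in>set \<nu>s. typeIIa_param \<nu>"
        "\<forall>i<length ms. \<forall>j<length ms. \<nu>s ! i \<noteq> \<nu>s ! j \<longleftrightarrow> \<mu>s ! i \<noteq> \<mu>s ! j"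
      using A unfolding congruence_bundle_def by auto
    let ?as = "replicate (length ls) (1 :: complex)"
    let ?ms = "ms @ ps" and ?\<mu>s = "\<mu>s @ map (\<lambda>p. (- 1) ^ p) ps"
    have sizes: "\<forall>k\<in>set (ks @ ls @ ?ms). k \<ge> 1" and len: "length \<mu>s = length ms"
        and IIa: "\<forall>\<mu>\<in>set \<mu>s. typeIIa_param \<mu>" and cong: "congruent_mat A (cfc_mat ks ls ms \<mu>s ps)"
      using cfc unfolding is_cfc_def by auto
    obtain Q where Q: "Q \<in> carrier_mat n n" "invertible_mat Q"
        "cfc_mat ks ls ms \<mu>s ps = transpose_mat Q * A * Q"
      using cong A unfolding congruent_mat_def by auto
    have "trans.generic n m (cfc_mat ks ls ms \<mu>s ps)"
      using trans.generic_congruence[OF gen Q(1)] Q invertible_mat_iff_det[OF Q(1)]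
      by (simp add: sadj_eq_transpose_mat)
    hence g: "trans.generic n m (star_cfc_mat ks ls ?as ?ms ?\<mu>s)"
      by (simp add: cfc_mat_eq_star_cfc_mat[OF len])
    have nz: "\<forall>\<alpha>\<in>set ?as. \<alpha> \<noteq> 0" "\<forall>\<mu>\<in>set ?\<mu>s. \<mu> \<noteq> 0" "length ?as = length ls" "length ?\<mu>s = length ?ms"
      using IIa trans.U_nonzero len by auto
    note form = trans.generic_star_cfc_mat[OF sizes nz(3,4,1,2) g]
    \<comment> \<open>The parameter \<open>(- 1) ^ p\<close> equals its own inverse, but no
      parameter of an \<open>H_block\<close> in a generic form is fixed by \<tau>.\<close>
    have ps: "ps = []"
    proof (rule ccontr)
      assume "ps \<noteq> []"
      then obtain p where "p \<in> set ps" by (cases ps) auto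
      hence "trans.\<tau> ((- 1) ^ p) \<noteq> (- 1) ^ p" using form(6) by auto
      thus False unfolding trans.\<tau>_def by (cases "even p") auto
    qed
    have ls: "ls = replicate (length ls) 1" and ms: "ms = replicate (length ms) 1"
      using form(2,3) by (auto intro: replicate_eqI)
    have C: "cfc_mat ks ls ms \<nu>s ps = diag_block_mat (map scalar_block ?as @ map (H_block 1) \<nu>s)"
      unfolding cfc_mat_eq_star_cfc_mat[OF \<nu>s(1)] form(1) ps
      using star_cfc_mat_ones[of ?as "length ls" \<nu>s "length ms"] ls ms \<nu>s(1) by simp
    have "distinct \<nu>s"
      using form(5) ps \<nu>s(1,3) len by (auto simp: distinct_conv_nth)
    moreover have "length ?as = m" "m + 2 * length \<nu>s = n" using form(7,8) ps \<nu>s(1) by auto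
    ultimately have "trans.generic n m (cfc_mat ks ls ms \<nu>s ps)"
      unfolding C using nz(1) \<nu>s(2) form(4) by (intro trans.generic_canonical)
    from trans.generic_congruence[OF this, of "transpose_mat P"]
    show "B \<in> {B. trans.generic n m B}"
      using P invertible_mat_iff_det[OF P(1)] det_transpose[OF P(1)] unfolding B
      by (simp add: sadj_eq_transpose_mat)
  qed
  show "{B. trans.generic n m B} \<subseteq> congruence_bundle A"
  proof
    fix B assume "B \<in> {B. trans.generic n m B}"
    hence genB: "trans.generic n m B" by simp
    obtain \<alpha>s \<mu>s Q where Q: "length \<alpha>s = m" "m + 2 * length \<mu>s = n" "\<forall>\<alpha>\<in>set \<alpha>s. \<alpha> = 1"
        "\<forall>\<mu>\<in>set \<mu>s. typeIIa_param \<mu>" "distinct \<mu>s" "Q \<in> carrier_mat n n" "det Q \<noteq> 0"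
        "transpose_mat Q * A * Q = diag_block_mat (map scalar_block \<alpha>s @ map (H_block 1) \<mu>s)"
      by (rule trans.generic_normal_form[OF gen, unfolded sadj_eq_transpose_mat]) (rule that)
    obtain \<beta>s \<nu>s P where P: "length \<beta>s = m" "m + 2 * length \<nu>s = n" "\<forall>\<alpha>\<in>set \<beta>s. \<alpha> = 1"
        "\<forall>\<mu>\<in>set \<nu>s. typeIIa_param \<mu>" "distinct \<nu>s" "P \<in> carrier_mat n n" "det P \<noteq> 0"
        "B = P * diag_block_mat (map scalar_block \<beta>s @ map (H_block 1) \<nu>s) * transpose_mat P"
      by (rule trans.generic_decomposition[OF genB, unfolded sadj_eq_transpose_mat]) (rule that)
    have len: "length \<nu>s = length \<mu>s" using P(2) Q(2) by simp
    let ?ls = "replicate m 1" and ?ms = "replicate (length \<mu>s) 1"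
    have \<alpha>s: "\<alpha>s = replicate m 1" "\<beta>s = replicate m 1"
      using P(1,3) Q(1,3) by (auto intro: replicate_eqI)
    have C: "cfc_mat [] ?ls ?ms \<xi>s [] = diag_block_mat (map scalar_block (replicate m 1) @ map (H_block 1) \<xi>s)"
      if "length \<xi>s = length \<mu>s" for \<xi>s
      using star_cfc_mat_ones[of "replicate m 1" m \<xi>s "length \<mu>s"] that
      by (simp add: cfc_mat_eq_star_cfc_mat)
    have "is_cfc A [] ?ls ?ms \<mu>s []"
      unfolding is_cfc_def congruent_mat_def using A Q C[of \<mu>s] invertible_mat_iff_det[OF Q(6)] \<alpha>s
      by (auto intro!: bexI[of _ Q])
    moreover have "\<forall>i<length ?ms. \<forall>j<length ?ms. \<nu>s ! i \<noteq> \<nu>s ! j \<longleftrightarrow> \<mu>s ! i \<noteq> \<mu>s ! j"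
      using Q(5) P(5) len by (simp add: nth_eq_iff_index_eq)
    moreover have "B = P * cfc_mat [] ?ls ?ms \<nu>s [] * transpose_mat P" using P(8) C[OF len] \<alpha>s by simp
    moreover have "invertible_mat P" using invertible_mat_iff_det[OF P(6)] P(7) by simp
    moreover have "P \<in> carrier_mat (dim_row A) (dim_row A)" using P(6) A by simp
    moreover have "length \<nu>s = length ?ms" using len by simp
    ultimately show "B \<in> congruence_bundle A" unfolding congruence_bundle_def using P(4) by blast
  qed
qed

text \<open>The root of a unit scalar is its square, which is why the definition of the bundle
  compares squares.\<close>

lemma div_cnj_unit: "cmod \<alpha> = 1 \<Longrightarrow> \<alpha> / cnj \<alpha> = \<alpha>\<^sup>2"
  using complex_norm_square[of \<alpha>] by (cases "\<alpha> = 0") (auto simp: field_simps power2_eq_square)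

lemma star_congruence_bundle_generic:
  assumes gen: "star.generic n m A"
  shows "star_congruence_bundle A = {B. star.generic n m B}"
proof
  have A: "A \<in> carrier_mat n n" using gen unfolding star.generic_def by simp
  have squares: "map (\<lambda>\<alpha>. \<alpha> / cnj \<alpha>) xs = map (\<lambda>\<alpha>. \<alpha>\<^sup>2) xs" if "\<forall>\<alpha>\<in>set xs. cmod \<alpha> = 1" for xs
    using that div_cnj_unit by auto
  show "star_congruence_bundle A \<subseteq> {B. star.generic n m B}"
  proof
    fix B assume "B \<in> star_congruence_bundle A"
    then obtain P ks ls \<alpha>s \<beta>s ms \<mu>s \<nu>s where B: "B = P * star_cfc_mat ks ls \<beta>s ms \<nu>s * mat_adjoint P"
      and cfc: "is_star_cfc A ks ls \<alpha>s ms \<mu>s" and P: "P \<in> carrier_mat n n" "invertible_mat P"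
      and \<beta>s: "length \<beta>s = length ls" "\<forall>\<beta>\<in>set \<beta>s. cmod \<beta> = 1"
      and \<nu>s: "length \<nu>s = length ms" "\<forall>\<nu>\<in>set \<nu>s. cmod \<nu> > 1"
      and eq\<beta>: "\<forall>i<length ls. \<forall>j<length ls. ls ! i mod 2 = ls ! j mod 2 \<longrightarrow>
              ((\<beta>s ! i)\<^sup>2 \<noteq> (\<beta>s ! j)\<^sup>2 \<longleftrightarrow> (\<alpha>s ! i)\<^sup>2 \<noteq> (\<alpha>s ! j)\<^sup>2)"
      and eq\<nu>: "\<forall>i<length ms. \<forall>j<length ms. \<nu>s ! i \<noteq> \<nu>s ! j \<longleftrightarrow> \<mu>s ! i \<noteq> \<mu>s ! j"
      using A unfolding star_congruence_bundle_def by auto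
    have sizes: "\<forall>k\<in>set (ks @ ls @ ms). k \<ge> 1" and len: "length \<alpha>s = length ls" "length \<mu>s = length ms"
        and \<alpha>s: "\<forall>\<alpha>\<in>set \<alpha>s. cmod \<alpha> = 1" and \<mu>s: "\<forall>\<mu>\<in>set \<mu>s. cmod \<mu> > 1"
        and cong: "star_congruent_mat A (star_cfc_mat ks ls \<alpha>s ms \<mu>s)"
      using cfc unfolding is_star_cfc_def by auto
    obtain Q where Q: "Q \<in> carrier_mat n n" "invertible_mat Q"
        "star_cfc_mat ks ls \<alpha>s ms \<mu>s = mat_adjoint Q * A * Q"
      using cong A unfolding star_congruent_mat_def by auto
    have g: "star.generic n m (star_cfc_mat ks ls \<alpha>s ms \<mu>s)"
      using star.generic_congruence[OF gen Q(1)] Q invertible_mat_iff_det[OF Q(1)]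
      by (simp add: sadj_eq_mat_adjoint)
    have nz: "\<forall>\<alpha>\<in>set \<alpha>s. \<alpha> \<noteq> 0" "\<forall>\<mu>\<in>set \<mu>s. \<mu> \<noteq> 0" "\<forall>\<beta>\<in>set \<beta>s. \<beta> \<noteq> 0"
      using \<alpha>s \<mu>s \<beta>s(2) by fastforce+
    note form = star.generic_star_cfc_mat[OF sizes len nz(1,2) g]
    have ls: "ls = replicate (length ls) 1" and ms: "ms = replicate (length ms) 1"
      using form(2,3) by (auto intro: replicate_eqI)
    have C: "star_cfc_mat ks ls \<beta>s ms \<nu>s = diag_block_mat (map scalar_block \<beta>s @ map (H_block 1) \<nu>s)"
      unfolding form(1) using star_cfc_mat_ones[OF \<beta>s(1) \<nu>s(1)] ls ms by simp
    have "distinct \<nu>s"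
      using form(5) \<nu>s(1) eq\<nu> len by (auto simp: distinct_conv_nth)
    moreover have "distinct (map (\<lambda>\<alpha>. \<alpha> / cnj \<alpha>) \<beta>s)"
    proof -
      have "(\<beta>s ! i)\<^sup>2 \<noteq> (\<beta>s ! j)\<^sup>2" if ij: "i < length ls" "j < length ls" "i \<noteq> j" for i j
      proof -
        \<comment> \<open>All Type I blocks have size 1, so their sizes always have equal
          parity.\<close>
        have "ls ! i mod 2 = ls ! j mod 2"
          using form(2) nth_mem[OF ij(1)] nth_mem[OF ij(2)] by metis
        hence "(\<beta>s ! i)\<^sup>2 \<noteq> (\<beta>s ! j)\<^sup>2 \<longleftrightarrow> (\<alpha>s ! i)\<^sup>2 \<noteq> (\<alpha>s ! j)\<^sup>2" using eq\<beta> ij by blast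
        thus ?thesis
          using form(4) ij len(1) unfolding squares[OF \<alpha>s] distinct_conv_nth by simp
      qed
      thus ?thesis unfolding squares[OF \<beta>s(2)] distinct_conv_nth using \<beta>s(1) by simp
    qed
    moreover have "length \<beta>s = m" "m + 2 * length \<nu>s = n" using form(7,8) \<beta>s(1) \<nu>s(1) by auto
    ultimately have "star.generic n m (star_cfc_mat ks ls \<beta>s ms \<nu>s)"
      unfolding C using nz(3) \<nu>s(2) by (intro star.generic_canonical)
    \<comment> \<open>Congruence by the adjoint of \<open>P\<close> puts \<open>P\<close> itself on
      the left, as in the bundle.\<close>
    from star.generic_congruence[OF this, of "star.sadj P"]
    show "B \<in> {B. star.generic n m B}"
      using P invertible_mat_iff_det[OF P(1)] star.det_sadj[OF P(1)] unfolding B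
      by (simp flip: sadj_eq_mat_adjoint)
  qed
  show "{B. star.generic n m B} \<subseteq> star_congruence_bundle A"
  proof
    fix B assume "B \<in> {B. star.generic n m B}"
    hence genB: "star.generic n m B" by simp
    obtain \<alpha>s \<mu>s Q where Q: "length \<alpha>s = m" "m + 2 * length \<mu>s = n" "\<forall>\<alpha>\<in>set \<alpha>s. cmod \<alpha> = 1"
        "\<forall>\<mu>\<in>set \<mu>s. cmod \<mu> > 1" "distinct (map (\<lambda>\<alpha>. \<alpha> / cnj \<alpha>) \<alpha>s)" "distinct \<mu>s"
        "Q \<in> carrier_mat n n" "det Q \<noteq> 0"
        "mat_adjoint Q * A * Q = diag_block_mat (map scalar_block \<alpha>s @ map (H_block 1) \<mu>s)"
      by (rule star.generic_normal_form[OF gen, unfolded sadj_eq_mat_adjoint]) (rule that)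
    obtain \<beta>s \<nu>s P where P: "length \<beta>s = m" "m + 2 * length \<nu>s = n" "\<forall>\<alpha>\<in>set \<beta>s. cmod \<alpha> = 1"
        "\<forall>\<mu>\<in>set \<nu>s. cmod \<mu> > 1" "distinct (map (\<lambda>\<alpha>. \<alpha> / cnj \<alpha>) \<beta>s)" "distinct \<nu>s"
        "P \<in> carrier_mat n n" "det P \<noteq> 0"
        "B = P * diag_block_mat (map scalar_block \<beta>s @ map (H_block 1) \<nu>s) * mat_adjoint P"
      by (rule star.generic_decomposition[OF genB, unfolded sadj_eq_mat_adjoint]) (rule that)
    have len: "length \<nu>s = length \<mu>s" using P(2) Q(2) by simp
    let ?ls = "replicate m 1" and ?ms = "replicate (length \<mu>s) 1"
    have "is_star_cfc A [] ?ls \<alpha>s ?ms \<mu>s"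
      unfolding is_star_cfc_def star_congruent_mat_def
      using A Q star_cfc_mat_ones[OF Q(1) refl] invertible_mat_iff_det[OF Q(7)]
      by (auto intro!: bexI[of _ Q])
    moreover have "\<forall>i<length ?ms. \<forall>j<length ?ms. \<nu>s ! i \<noteq> \<nu>s ! j \<longleftrightarrow> \<mu>s ! i \<noteq> \<mu>s ! j"
      using Q(6) P(6) len by (simp add: nth_eq_iff_index_eq)
    moreover have "\<forall>i<length ?ls. \<forall>j<length ?ls.
           (?ls ! i mod 2 = ?ls ! j mod 2 \<longrightarrow>
              ((\<beta>s ! i)\<^sup>2 \<noteq> (\<beta>s ! j)\<^sup>2 \<longleftrightarrow> (\<alpha>s ! i)\<^sup>2 \<noteq> (\<alpha>s ! j)\<^sup>2)) \<and>
           (?ls ! i mod 2 \<noteq> ?ls ! j mod 2 \<longrightarrow>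
              ((\<beta>s ! i)\<^sup>2 \<noteq> - (\<beta>s ! j)\<^sup>2 \<longleftrightarrow> (\<alpha>s ! i)\<^sup>2 \<noteq> - (\<alpha>s ! j)\<^sup>2))"
      using Q(5) P(5) P(1) Q(1) unfolding squares[OF P(3)] squares[OF Q(3)]
      by (auto simp: distinct_conv_nth)
    moreover have "B = P * star_cfc_mat [] ?ls \<beta>s ?ms \<nu>s * mat_adjoint P"
      using P(9) star_cfc_mat_ones[OF P(1) len] by simp
    moreover have "invertible_mat P" using invertible_mat_iff_det[OF P(7)] P(8) by simp
    moreover have "P \<in> carrier_mat (dim_row A) (dim_row A)" using P(7) A by simp
    moreover have "length \<beta>s = length ?ls" "length \<nu>s = length ?ms" using len P(1) by auto
    ultimately show "B \<in> star_congruence_bundle A"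
      unfolding star_congruence_bundle_def using P(3,4) by blast
  qed
qed

lemma distinct_map_upt:
  assumes "\<forall>i\<in>{1..k}. \<forall>j\<in>{1..k}. i \<noteq> j \<longrightarrow> f i \<noteq> f j"
  shows "distinct (map f [1..<k + 1])"
proof -
  have "inj_on f {1..k}" using assms by (auto intro: inj_onI)
  moreover have "set [1..<k + 1] = {1..k}" by auto
  ultimately show ?thesis by (simp only: distinct_map distinct_upt)
qed

theorem theorem5p1:
  fixes n :: nat
  assumes "n \<ge> 1"
  shows
    "(\<forall>\<mu> :: nat \<Rightarrow> complex.
        (\<forall>i \<in> {1..n div 2}. typeIIa_param (\<mu> i)) \<and>
        (\<forall>i \<in> {1..n div 2}. \<forall>i' \<in> {1..n div 2}. i \<noteq> i' \<longrightarrow> \<mu> i \<noteq> \<mu> i') \<longrightarrow>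
        open_mat_set n
          (if even n
           then congruence_bundle (diag_block_mat (map (\<lambda>i. H_block 1 (\<mu> i)) [1..<n div 2 + 1]))
           else congruence_bundle (diag_block_mat
                  (map (\<lambda>i. H_block 1 (\<mu> i)) [1..<n div 2 + 1] @ [scalar_block 1])))) \<and>
     (\<forall>l \<in> {0..n div 2}. \<forall>(\<mu> :: nat \<Rightarrow> complex) (\<alpha> :: nat \<Rightarrow> complex).
        (\<forall>i \<in> {1..l}. cmod (\<mu> i) > 1) \<and>
        (\<forall>i \<in> {1..l}. \<forall>i' \<in> {1..l}. i \<noteq> i' \<longrightarrow> \<mu> i \<noteq> \<mu> i') \<and>
        (\<forall>j \<in> {1..n - 2 * l}. cmod (\<alpha> j) = 1) \<and>
        (\<forall>j \<in> {1..n - 2 * l}. \<forall>j' \<in> {1..n - 2 * l}. j \<noteq> j' \<longrightarrow> (\<alpha> j)\<^sup>2 \<noteq> (\<alpha> j')\<^sup>2) \<longrightarrow>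
        open_mat_set n
          (star_congruence_bundle (diag_block_mat
             (map (\<lambda>i. H_block 1 (\<mu> i)) [1..<l + 1] @
              map (\<lambda>j. scalar_block (\<alpha> j)) [1..<n - 2 * l + 1]))))"
proof (intro conjI allI ballI impI, goal_cases)
  case (1 \<mu>)
  define \<mu>s where "\<mu>s = map \<mu> [1..<n div 2 + 1]"
  \<comment> \<open>Its length, 0 or 1 according to the parity of \<open>n\<close>, is the number of
    fixed roots.\<close>
  define \<alpha>s :: "complex list" where "\<alpha>s = (if even n then [] else [1])"
  define Ds where "Ds = map (H_block 1) \<mu>s @ map scalar_block \<alpha>s"
  have "distinct \<mu>s" unfolding \<mu>s_def using 1 by (intro distinct_map_upt) auto
  moreover have "distinct (map (\<lambda>\<alpha>. \<alpha> / id \<alpha>) \<alpha>s)" "\<forall>\<alpha>\<in>set \<alpha>s. \<alpha> \<noteq> 0" unfolding \<alpha>s_def by auto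
  moreover have "\<forall>\<mu>\<in>set \<mu>s. typeIIa_param \<mu>" unfolding \<mu>s_def using 1 by auto
  ultimately have "trans.generic (length \<alpha>s + 2 * length \<mu>s) (length \<alpha>s) (diag_block_mat Ds)"
    unfolding Ds_def by (intro trans.generic_blocks) (auto simp: o_def sum_list_triv)
  moreover have "length \<alpha>s + 2 * length \<mu>s = n"
    unfolding \<alpha>s_def \<mu>s_def by (cases "even n") (auto elim!: evenE oddE)
  ultimately have "open_mat_set n (congruence_bundle (diag_block_mat Ds))"
    using trans.open_mat_set_generic congruence_bundle_generic by metis
  thus ?case unfolding Ds_def \<mu>s_def \<alpha>s_def by (auto simp: o_def)
next
  case (2 l \<mu> \<alpha>)
  define \<mu>s where "\<mu>s = map \<mu> [1..<l + 1]"
  define \<alpha>s where "\<alpha>s = map \<alpha> [1..<n - 2 * l + 1]"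
  define Ds where "Ds = map (H_block 1) \<mu>s @ map scalar_block \<alpha>s"
  have unit: "\<forall>\<alpha>\<in>set \<alpha>s. cmod \<alpha> = 1" unfolding \<alpha>s_def using 2 by auto
  \<comment> \<open>This turns the assumption of different squares into the required distinctness of
    the fixed roots.\<close>
  hence "map (\<lambda>\<alpha>. \<alpha> / cnj \<alpha>) \<alpha>s = map (\<lambda>j. (\<alpha> j)\<^sup>2) [1..<n - 2 * l + 1]"
    unfolding \<alpha>s_def by (auto simp: div_cnj_unit)
  hence "distinct (map (\<lambda>\<alpha>. \<alpha> / cnj \<alpha>) \<alpha>s)" using 2 by (simp only:) (intro distinct_map_upt, auto)
  moreover have "distinct \<mu>s" unfolding \<mu>s_def using 2 by (intro distinct_map_upt) auto
  moreover have "\<forall>\<alpha>\<in>set \<alpha>s. \<alpha> \<noteq> 0" using unit by auto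
  moreover have "\<forall>\<mu>\<in>set \<mu>s. cmod \<mu> > 1" unfolding \<mu>s_def using 2 by auto
  ultimately have "star.generic (length \<alpha>s + 2 * length \<mu>s) (length \<alpha>s) (diag_block_mat Ds)"
    unfolding Ds_def by (intro star.generic_blocks) (auto simp: o_def sum_list_triv)
  moreover have "length \<alpha>s + 2 * length \<mu>s = n" unfolding \<alpha>s_def \<mu>s_def using 2(1) by auto
  ultimately have "open_mat_set n (star_congruence_bundle (diag_block_mat Ds))"
    using star.open_mat_set_generic star_congruence_bundle_generic by metis
  thus ?case unfolding Ds_def \<mu>s_def \<alpha>s_def by (simp add: o_def)
qed

end
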